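(* $\mathrm{MC}(\times,/)$ is $\mathrm{PL}$-hard under logarithmic-space many-one reductions.
   Context: Natural numbers include $0$. For $A,B\subseteq\mathbb N$: $A\cup B$, $A\cap B$ are the usual operations, $\overline{A}=\mathbb N\setminus A$, $A+B=\{a+b: a\in A, b\in B\}$, $A\times B=\{a\cdot b: a\in A, b\in B\}$, and $A/B=\{c\in\mathbb N:\exists a\in A\ \exists b\in B\setminus\{0\}: a=c\cdot b\}$ (exact integer division without remainder or rounding). For $\emptyset\ne\mathcal O\subseteq\{\cup,\cap,\overline{\phantom{c}},+,\times,/\}$, an $\mathcal O$-circuit $C=(V,E,g_C,\alpha)$ is a finite acyclic directed multigraph with gate set $V\subseteq\mathbb N$, every gate having indegree $0$, $1$ or $2$, a designated output gate $g_C\in V$, and a labeling $\alpha$: gates of indegree $0$ (input gates) are labeled by natural numbers, gates of indegree $1$ are labeled $\overline{\phantom{c}}$ (allowed only if $\overline{\phantom{c}}\in\mathcal O$), and gates of indegree $2$ are labeled by an operation in $\mathcal O\setminus\{\overline{\phantom{c}}\}$. The result set $I(g)\subseteq\mathbb N$ is defined inductively: $I(g)=\{\alpha(g)\}$ for an input gate; $I(g)=\mathbb N\setminus I(p)$ for a complement gate with predecessor $p$; $I(g)=I(g_1)\,\sigma\,I(g_2)$ for a gate labeled $\sigma$ with predecessors $g_1\le g_2$ (a double edge from one gate gives $g_1=g_2$). $I(C)=I(g_C)$. A circuit is encoded as a bit string listing its gates in reverse topological order, each gate as the triple (gate name, label, list of predecessors), with all numbers (including input labels) in binary; $|C|$ denotes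 the length of this encoding. The membership problem is $\mathrm{MC}(\mathcal O)=\{(C,b): C \text{ is an } \mathcal O\text{-circuit},\ b\in\mathbb N,\ b\in I(C)\}$, with $b$ given in binary; $\mathrm{MC}(\sigma_1,\dots,\sigma_n)$ abbreviates $\mathrm{MC}(\{\sigma_1,\dots,\sigma_n\})$. $\mathrm{PL}$ is the class of languages accepted by probabilistic Turing machines running in polynomial time and logarithmic space with acceptance probability strictly greater than $1/2$. *)

theory Defs
  imports Complex_Main
begin

datatype op = OUnion | OInter | OCompl | OPlus | OTimes | ODiv

datatype label = In nat | Op op

text \<open>A gate is a triple (gate name, label, list of predecessors).
  A circuit is given as the list of its gates in reverse topological order
  (every predecessor of a gate occurs later in the list); the output gate is
  the first gate of the list.\<close>
type_synonym gate = "nat \<times> label \<times> nat list"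

definition gname :: "gate \<Rightarrow> nat" where "gname g = fst g"
definition glabel :: "gate \<Rightarrow> label" where "glabel g = fst (snd g)"
definition gpreds :: "gate \<Rightarrow> nat list" where "gpreds g = snd (snd g)"

definition set_plus :: "nat set \<Rightarrow> nat set \<Rightarrow> nat set" where
  "set_plus A B = {a + b | a b. a \<in> A \<and> b \<in> B}"
definition set_times :: "nat set \<Rightarrow> nat set \<Rightarrow> nat set" where
  "set_times A B = {a * b | a b. a \<in> A \<and> b \<in> B}"
definition set_div :: "nat set \<Rightarrow> nat set \<Rightarrow> nat set" where
  "set_div A B = {c. \<exists>a\<in>A. \<exists>b\<in>B - {0}. a = c * b}"

fun apply_op :: "op \<Rightarrow> nat set \<Rightarrow> nat set \<Rightarrow> nat set" where
  "apply_op OUnion A B = A \<union> B"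
| "apply_op OInter A B = A \<inter> B"
| "apply_op OCompl A B = UNIV - A"
| "apply_op OPlus A B = set_plus A B"
| "apply_op OTimes A B = set_times A B"
| "apply_op ODiv A B = set_div A B"

definition wf_circuit :: "op set \<Rightarrow> gate list \<Rightarrow> bool" where
  "wf_circuit Ops gs \<longleftrightarrow> gs \<noteq> [] \<and> distinct (map gname gs) \<and>
     (\<forall>i < length gs.
        (\<forall>p \<in> set (gpreds (gs ! i)). \<exists>j. i < j \<and> j < length gs \<and> gname (gs ! j) = p) \<and>
        (case glabel (gs ! i) of
           In k \<Rightarrow> gpreds (gs ! i) = []
         | Op OCompl \<Rightarrow> length (gpreds (gs ! i)) = 1 \<and> OCompl \<in> Ops
         | Op f \<Rightarrow> length (gpreds (gs ! i)) = 2 \<and> f \<in> Ops))"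

text \<open>Result sets, computed from the end of the list (inputs) to the front.
  For a binary gate with predecessors g1 \<le> g2 the result is I(g1) op I(g2).\<close>
fun gate_val :: "label \<Rightarrow> nat set list \<Rightarrow> nat set" where
  "gate_val (In k) _ = {k}"
| "gate_val (Op OCompl) xs = UNIV - hd xs"
| "gate_val (Op f) xs = apply_op f (xs ! 0) (xs ! 1)"

fun eval_gates :: "gate list \<Rightarrow> nat \<Rightarrow> nat set" where
  "eval_gates [] = (\<lambda>_. {})"
| "eval_gates (g # gs) =
     (let e = eval_gates gs in e(gname g := gate_val (glabel g) (map e (sort (gpreds g)))))"

definition circuit_val :: "gate list \<Rightarrow> nat set" where
  "circuit_val gs = eval_gates gs (gname (hd gs))"

fun bin :: "nat \<Rightarrow> bool list" where
  "bin n = (if n < 2 then [n = 1] else bin (n div 2) @ [odd n])"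

datatype sym = D0 | D1 | Comma | Semi | Hash | SU | SI | SC | SP | ST | SD

fun sym_bits :: "sym \<Rightarrow> bool list" where
  "sym_bits D0    = [False, False, False, False]"
| "sym_bits D1    = [False, False, False, True]"
| "sym_bits Comma = [False, False, True, False]"
| "sym_bits Semi  = [False, False, True, True]"
| "sym_bits Hash  = [False, True, False, False]"
| "sym_bits SU    = [False, True, False, True]"
| "sym_bits SI    = [False, True, True, False]"
| "sym_bits SC    = [False, True, True, True]"
| "sym_bits SP    = [True, False, False, False]"
| "sym_bits ST    = [True, False, False, True]"
| "sym_bits SD    = [True, False, True, False]"

definition enc_num :: "nat \<Rightarrow> sym list" where
  "enc_num n = map (\<lambda>b. if b then D1 else D0) (bin n)"

fun enc_op :: "op \<Rightarrow> sym" where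
  "enc_op OUnion = SU" | "enc_op OInter = SI" | "enc_op OCompl = SC"
| "enc_op OPlus = SP" | "enc_op OTimes = ST" | "enc_op ODiv = SD"

fun enc_label :: "label \<Rightarrow> sym list" where
  "enc_label (In k) = enc_num k"
| "enc_label (Op f) = [enc_op f]"

definition enc_gate :: "gate \<Rightarrow> sym list" where
  "enc_gate g = enc_num (gname g) @ [Comma] @ enc_label (glabel g) @
                 concat (map (\<lambda>p. Comma # enc_num p) (gpreds g)) @ [Semi]"

definition enc_instance :: "gate list \<Rightarrow> nat \<Rightarrow> bool list" where
  "enc_instance gs b = concat (map sym_bits (concat (map enc_gate gs) @ [Hash] @ enc_num b))"

definition MC :: "op set \<Rightarrow> bool list set" where
  "MC Ops = {enc_instance gs b | gs b. wf_circuit Ops gs \<and> b \<in> circuit_val gs}"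

text \<open>Input tape: read-only, cells 0..n+1 with end markers (None) at 0 and n+1.
  Work tape: one-way infinite, symbols are naturals < nsyms, 0 is blank.
  States are naturals < nstates. Moves are -1, 0, 1.\<close>

definition inp :: "bool list \<Rightarrow> nat \<Rightarrow> bool option" where
  "inp x i = (if 1 \<le> i \<and> i \<le> length x then Some (x ! (i - 1)) else None)"

definition move :: "nat \<Rightarrow> int \<Rightarrow> nat \<Rightarrow> nat" where
  "move h d bound = nat (min (int bound) (max 0 (int h + d)))"

record ptm =
  p_nstates :: nat
  p_nsyms :: nat
  p_start :: nat
  p_acc :: nat
  p_rej :: nat
  p_delta :: "nat \<Rightarrow> bool option \<Rightarrow> nat \<Rightarrow> bool \<Rightarrow> nat \<times> int \<times> nat \<times> int"

text \<open>configuration: (state, input head, work tape, work head)\<close>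
type_synonym pconf = "nat \<times> nat \<times> (nat \<Rightarrow> nat) \<times> nat"

definition ptm_wf :: "ptm \<Rightarrow> bool" where
  "ptm_wf M \<longleftrightarrow> p_start M < p_nstates M \<and> p_acc M < p_nstates M \<and> p_rej M < p_nstates M \<and>
     p_acc M \<noteq> p_rej M \<and> 0 < p_nsyms M \<and>
     (\<forall>q < p_nstates M. \<forall>s a coin. a < p_nsyms M \<longrightarrow>
        (case p_delta M q s a coin of (q', d, a', e) \<Rightarrow>
           q' < p_nstates M \<and> a' < p_nsyms M \<and> d \<in> {-1, 0, 1} \<and> e \<in> {-1, 0, 1}))"

definition ptm_halted :: "ptm \<Rightarrow> pconf \<Rightarrow> bool" where
  "ptm_halted M c \<longleftrightarrow> fst c = p_acc M \<or> fst c = p_rej M"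

definition ptm_step :: "ptm \<Rightarrow> bool list \<Rightarrow> pconf \<Rightarrow> bool \<Rightarrow> pconf" where
  "ptm_step M x c coin =
     (if ptm_halted M c then c else
      (case c of (q, ih, tp, wh) \<Rightarrow>
        (case p_delta M q (inp x ih) (tp wh) coin of (q', d, a', e) \<Rightarrow>
          (q', move ih d (length x + 1), tp(wh := a'), nat (max 0 (int wh + e))))))"

definition ptm_run :: "ptm \<Rightarrow> bool list \<Rightarrow> bool list \<Rightarrow> pconf" where
  "ptm_run M x cs = foldl (ptm_step M x) (p_start M, 0, (\<lambda>_. 0), 0) cs"

definition ptm_accepts :: "ptm \<Rightarrow> bool list \<Rightarrow> bool list \<Rightarrow> bool" where
  "ptm_accepts M x cs \<longleftrightarrow> fst (ptm_run M x cs) = p_acc M"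

definition PL :: "bool list set set" where
  "PL = {L. \<exists>M k c. ptm_wf M \<and>
      (\<forall>x cs. length cs = (length x + 2) ^ k \<longrightarrow> ptm_halted M (ptm_run M x cs)) \<and>
      (\<forall>x cs. real (snd (snd (snd (ptm_run M x cs)))) \<le> c * log 2 (real (length x) + 2)) \<and>
      (\<forall>x. x \<in> L \<longleftrightarrow>
         2 * card {cs. length cs = (length x + 2) ^ k \<and> ptm_accepts M x cs}
           > 2 ^ ((length x + 2) ^ k))}"

text \<open>Deterministic logspace transducer: read-only input, one work tape, write-only
  output tape (each step optionally appends one output bit).\<close>
record tdr =
  t_nstates :: nat
  t_nsyms :: nat
  t_start :: nat
  t_halt :: nat
  t_delta :: "nat \<Rightarrow> bool option \<Rightarrow> nat \<Rightarrow> nat \<times> int \<times> nat \<times> int \<times> bool option"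

type_synonym tconf = "nat \<times> nat \<times> (nat \<Rightarrow> nat) \<times> nat \<times> bool list"

definition tdr_wf :: "tdr \<Rightarrow> bool" where
  "tdr_wf T \<longleftrightarrow> t_start T < t_nstates T \<and> t_halt T < t_nstates T \<and> 0 < t_nsyms T \<and>
     (\<forall>q < t_nstates T. \<forall>s a. a < t_nsyms T \<longrightarrow>
        (case t_delta T q s a of (q', d, a', e, out) \<Rightarrow>
           q' < t_nstates T \<and> a' < t_nsyms T \<and> d \<in> {-1, 0, 1} \<and> e \<in> {-1, 0, 1}))"

definition tdr_step :: "tdr \<Rightarrow> bool list \<Rightarrow> tconf \<Rightarrow> tconf" where
  "tdr_step T x c =
     (case c of (q, ih, tp, wh, out) \<Rightarrow>
       (if q = t_halt T then c else
        (case t_delta T q (inp x ih) (tp wh) of (q', d, a', e, ob) \<Rightarrow>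
          (q', move ih d (length x + 1), tp(wh := a'), nat (max 0 (int wh + e)),
           out @ (case ob of None \<Rightarrow> [] | Some b \<Rightarrow> [b])))))"

definition tdr_conf :: "tdr \<Rightarrow> bool list \<Rightarrow> nat \<Rightarrow> tconf" where
  "tdr_conf T x t = (tdr_step T x ^^ t) (t_start T, 0, (\<lambda>_. 0), 0, [])"

definition logspace_reducible :: "bool list set \<Rightarrow> bool list set \<Rightarrow> bool" where
  "logspace_reducible L L' \<longleftrightarrow> (\<exists>T c. tdr_wf T \<and>
     (\<forall>x. \<exists>t. fst (tdr_conf T x t) = t_halt T) \<and>
     (\<forall>x t. real (fst (snd (snd (snd (tdr_conf T x t))))) \<le> c * log 2 (real (length x) + 2)) \<and>
     (\<forall>x t. fst (tdr_conf T x t) = t_halt T \<longrightarrow>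
        (x \<in> L \<longleftrightarrow> snd (snd (snd (snd (tdr_conf T x t)))) \<in> L')))"

definition PL_hard :: "bool list set \<Rightarrow> bool" where
  "PL_hard L' \<longleftrightarrow> (\<forall>L \<in> PL. logspace_reducible L L')"

end

theory Submission
  imports Defs
begin

text \<open>
  Write \<open>N\<close> for the running time of the given probabilistic machine \<open>M\<close> on \<open>x\<close>. The circuit has a
  gate for every pair of a time \<open>u \<le> N\<close> and a configuration; it multiplies the gates of the two
  successor configurations at time \<open>u + 1\<close>, and at time \<open>N\<close> it is a leaf with value 4 if the
  configuration accepts and 1 otherwise. The start configuration thus has value \<open>4 ^ A\<close>, with
  \<open>A\<close> the number of accepting coin sequences. A dummy configuration that is its own successor, with
  leaf 2, yields \<open>2 ^ 2 ^ N\<close>. Dividing, \<open>D = (4 ^ A / 2 ^ 2 ^ N) / 2\<close> is nonempty iff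
  \<open>2 * A > 2 ^ N\<close>, and then \<open>D / D\<close> is \<open>{1}\<close>.

  The transducer is obtained by compiling structured programs over polynomially bounded registers.
  A gate is named by the number with binary digits \<open>1 1\<dots>10 1\<dots>10 \<dots>\<close>, where each block spells a
  component of the configuration in unary: such names have polynomial length, and every component
  that occurs is an affine function of loop counters, so they are printed by counting loops alone.
  The two halves of the work tape are numbers written in base \<open>b\<close>, the number of symbols plus one.
\<close>

section \<open>Register programs and their execution by a transducer\<close>

text \<open>Halted configurations stand still, so every coin sequence is a path of length exactly
  \<open>N\<close>, and multiplying two successors adds their numbers of accepting paths in the
  exponent. The leaf 4 doubles that exponent, so that \<open>2 * A\<close> meets
  \<open>2 ^ N\<close> without halving. Exact division by \<open>2 ^ 2 ^ N\<close> alone would test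
  \<open>2 * A >= 2 ^ N\<close>; the further factor 2 makes the inequality strict. Two obstacles
  shape the construction. The program does not decide which configurations are reachable but prints
  a gate for every tuple in a box, so tuples that stand for no configuration also need predecessors
  inside the box or must be leaves. And predecessors are evaluated in ascending order of their names
  although division is not commutative, so each divisor needs a larger name than its dividend.
  Affine names are possible because pushing or popping a tape symbol multiplies or divides by
  \<open>b\<close>, while the digit concerned is fixed in the program text.\<close>

datatype 'r test = Zero 'r | Sym "bool option"

datatype 'r com = Skip | Out bool | Inc 'r | Dec 'r | Seq "'r com" "'r com"
  | Cond "'r test" "'r com" "'r com" | Until "'r test" "'r com"

fun holds :: "'r \<Rightarrow> bool list \<Rightarrow> 'r test \<Rightarrow> ('r \<Rightarrow> nat) \<Rightarrow> bool" where
  "holds h x (Zero r) s \<longleftrightarrow> s r = 0"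
| "holds h x (Sym y) s \<longleftrightarrow> inp x (s h) = y"

text \<open>Register \<open>h\<close> is the position of the input head; the other registers are counters bounded by \<open>B\<close>.\<close>

inductive exec :: "'r \<Rightarrow> bool list \<Rightarrow> nat \<Rightarrow> 'r com \<Rightarrow> ('r \<Rightarrow> nat) \<Rightarrow> ('r \<Rightarrow> nat) \<Rightarrow> bool list \<Rightarrow> bool"
  for h x B where
  Skip: "exec h x B Skip s s []"
| Out: "exec h x B (Out b) s s [b]"
| Inc: "s r < B \<Longrightarrow> r = h \<longrightarrow> s r \<le> length x \<Longrightarrow> exec h x B (Inc r) s (s(r := Suc (s r))) []"
| Dec: "0 < s r \<Longrightarrow> exec h x B (Dec r) s (s(r := s r - 1)) []"
| Seq: "exec h x B c s s' v \<Longrightarrow> exec h x B d s' s'' w \<Longrightarrow> exec h x B (Seq c d) s s'' (v @ w)"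
| Cond: "exec h x B (if holds h x t s then c else d) s s' w \<Longrightarrow> exec h x B (Cond t c d) s s' w"
| Until_stop: "holds h x t s \<Longrightarrow> exec h x B (Until t c) s s []"
| Until_loop: "\<not> holds h x t s \<Longrightarrow> exec h x B c s s' v \<Longrightarrow> exec h x B (Until t c) s' s'' w
    \<Longrightarrow> exec h x B (Until t c) s s'' (v @ w)"

text \<open>
  The control state is a stack of programs still to be executed. Every register has a binary track on the
  work tape, least significant bit first, with \<open>None\<close> beyond its last bit; cell 0 carries a mark.
  An instruction on a register starts at cell 0 in phase \<open>Go\<close>, moves right until the carry, borrow or
  zero test is settled, and returns to the mark in phase \<open>Back\<close>, which remembers the outcome.
\<close>

datatype phase = Start | Go | Back bool

type_synonym 'r cell = "bool \<times> ('r \<Rightarrow> bool option)"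
type_synonym 'r state = "'r com list \<times> phase"
type_synonym 'r mconf = "'r state \<times> nat \<times> (nat \<Rightarrow> 'r cell) \<times> nat \<times> bool list"

definition upd :: "'r cell \<Rightarrow> 'r \<Rightarrow> bool option \<Rightarrow> 'r cell" where
  "upd a r v = (fst a, (snd a)(r := v))"

fun sweeps :: "'r com \<Rightarrow> 'r \<Rightarrow> bool" where
  "sweeps (Inc r) r' = (r' = r)"
| "sweeps (Dec r) r' = (r' = r)"
| "sweeps (Cond (Zero r) c d) r' = (r' = r)"
| "sweeps _ r' = False"

text \<open>In the second component \<open>None\<close> means go on to the right, and
  \<open>Some b\<close> means stop with outcome \<open>b\<close>. \<open>Inc\<close> may write over
  \<open>None\<close> and so open a new cell, while \<open>Dec\<close> may leave leading zeros;
  hence a zero test has to read up to the first \<open>None\<close>.\<close>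

fun sweep_cell :: "'r com \<Rightarrow> bool option \<Rightarrow> bool option \<times> bool option" where
  "sweep_cell (Inc r) v = (if v = Some True then (Some False, None) else (Some True, Some True))"
| "sweep_cell (Dec r) v = (if v = Some False then (Some True, None) else (Some False, Some True))"
| "sweep_cell _ v = (v, if v = Some False then None else Some (v = None))"

definition sweep_step :: "'r com \<Rightarrow> 'r \<Rightarrow> 'r com list \<Rightarrow> 'r cell
    \<Rightarrow> 'r state \<times> int \<times> 'r cell \<times> int \<times> bool option" where
  "sweep_step c r ks a = (case sweep_cell c (snd a r) of
     (v, None) \<Rightarrow> ((c # ks, Go), 0, upd a r v, 1, None)
   | (v, Some b) \<Rightarrow> ((c # ks, Back b), 0, upd a r v, 0, None))"

text \<open>Register \<open>h\<close> has a track like any other and is the input head position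
  besides, so completing its \<open>Inc\<close> or \<open>Dec\<close> also moves the head.\<close>

fun finish :: "'r \<Rightarrow> 'r com \<Rightarrow> 'r com list \<Rightarrow> bool \<Rightarrow> 'r com list \<times> int" where
  "finish h (Inc r) ks b = (ks, if r = h then 1 else 0)"
| "finish h (Dec r) ks b = (ks, if r = h then -1 else 0)"
| "finish h (Cond t c d) ks b = ((if b then c else d) # ks, 0)"
| "finish h c ks b = (c # ks, 0)"

fun delta :: "'r \<Rightarrow> 'r state \<Rightarrow> bool option \<Rightarrow> 'r cell
    \<Rightarrow> 'r state \<times> int \<times> 'r cell \<times> int \<times> bool option" where
  "delta h (ks, Start) y a = ((ks, Go), 0, (True, snd a), 0, None)"
| "delta h (c # ks, Back b) y a =
     (if fst a then (case finish h c ks b of (ks', d) \<Rightarrow> ((ks', Go), d, a, 0, None))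
      else ((c # ks, Back b), 0, a, -1, None))"
| "delta h (Skip # ks, Go) y a = ((ks, Go), 0, a, 0, None)"
| "delta h (Out b # ks, Go) y a = ((ks, Go), 0, a, 0, Some b)"
| "delta h (Seq c d # ks, Go) y a = ((c # d # ks, Go), 0, a, 0, None)"
| "delta h (Until t c # ks, Go) y a = ((Cond t Skip (Seq c (Until t c)) # ks, Go), 0, a, 0, None)"
| "delta h (Cond (Sym z) c d # ks, Go) y a = (((if y = z then c else d) # ks, Go), 0, a, 0, None)"
| "delta h (Cond (Zero r) c d # ks, Go) y a = sweep_step (Cond (Zero r) c d) r ks a"
| "delta h (Inc r # ks, Go) y a = sweep_step (Inc r) r ks a"
| "delta h (Dec r # ks, Go) y a = sweep_step (Dec r) r ks a"
| "delta h ([], p) y a = (([], p), 0, a, 0, None)"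

fun mstep :: "'r \<Rightarrow> bool list \<Rightarrow> 'r mconf \<Rightarrow> 'r mconf" where
  "mstep h x (q, ih, tp, wh, out) =
     (if q = ([], Go) then (q, ih, tp, wh, out) else
      (case delta h q (inp x ih) (tp wh) of (q', d, a', e, ob) \<Rightarrow>
        (q', move ih d (length x + 1), tp(wh := a'), nat (max 0 (int wh + e)),
         out @ (case ob of None \<Rightarrow> [] | Some b \<Rightarrow> [b]))))"

definition whead :: "'r mconf \<Rightarrow> nat" where "whead c = fst (snd (snd (snd c)))"

text \<open>The space bound is part of the step relation. It is stated exponentially, so that a
  polynomial \<open>D\<close> becomes a logarithmic bound on the head by a single logarithm at the
  end.\<close>

definition bstep :: "'r \<Rightarrow> bool list \<Rightarrow> nat \<Rightarrow> 'r mconf \<Rightarrow> 'r mconf \<Rightarrow> bool" where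
  "bstep h x D c c' \<longleftrightarrow> 2 ^ whead c \<le> D \<and> c' = mstep h x c"

abbreviation "reach h x D \<equiv> (bstep h x D)\<^sup>*\<^sup>*"

lemma reach1: "2 ^ whead c \<le> D \<Longrightarrow> reach h x D c (mstep h x c)"
  by (simp add: bstep_def r_into_rtranclp)

lemma move_0 [simp]: "i \<le> N \<Longrightarrow> move i 0 N = i"
  by (simp add: move_def)

lemma sweep_forward:
  assumes "sweeps c r" "ih \<le> length x + 1" "2 ^ p \<le> D" "q \<le> p"
    and "\<And>j. j < p \<Longrightarrow> snd (sweep_cell c (snd (tp j) r)) = None"
  shows "reach h x D ((c # ks, Go), ih, tp, 0, out)
    ((c # ks, Go), ih, (\<lambda>j. if j < q then upd (tp j) r (fst (sweep_cell c (snd (tp j) r))) else tp j), q, out)"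
  using assms(4)
proof (induction q)
  case (Suc q)
  let ?tp = "\<lambda>q j. if j < q then upd (tp j) r (fst (sweep_cell c (snd (tp j) r))) else tp j"
  let ?c = "((c # ks, Go), ih, ?tp q, q, out)"
  have "2 ^ q \<le> (2 ^ p :: nat)" using Suc.prems by (intro power_increasing) auto
  then have "2 ^ q \<le> D" using assms(3) by (rule order_trans)
  then have "reach h x D ?c (mstep h x ?c)" by (intro reach1) (simp add: whead_def)
  moreover have "delta h (c # ks, Go) y a = sweep_step c r ks a" for y a
    using assms(1) by (cases "(c, r)" rule: sweeps.cases) auto
  then have "mstep h x ?c = ((c # ks, Go), ih, ?tp (Suc q), Suc q, out)"
    using assms(2) assms(5)[of q] Suc.prems
    by (auto simp: sweep_step_def fun_eq_iff nat_add_distrib split: prod.splits option.splits)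
  moreover have "reach h x D ((c # ks, Go), ih, tp, 0, out) ?c" using Suc by auto
  ultimately show ?case by (auto intro: rtranclp_trans)
qed auto

lemma sweep_back:
  assumes "ih \<le> length x + 1" "2 ^ p \<le> D" "q \<le> p" "\<And>j. fst (tp j) \<longleftrightarrow> j = 0"
  shows "reach h x D ((c # ks, Back b), ih, tp, q, out) ((c # ks, Back b), ih, tp, 0, out)"
  using assms(3)
proof (induction q)
  case (Suc q)
  let ?c = "((c # ks, Back b), ih, tp, Suc q, out)"
  have "2 ^ Suc q \<le> (2 ^ p :: nat)" using Suc.prems by (intro power_increasing) auto
  then have "2 ^ Suc q \<le> D" using assms(2) by (rule order_trans)
  then have "reach h x D ?c (mstep h x ?c)" by (intro reach1) (simp add: whead_def)
  moreover have "mstep h x ?c = ((c # ks, Back b), ih, tp, q, out)"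
    using assms(1,4) by auto
  ultimately show ?case using Suc by (auto intro: rtranclp_trans)
qed auto

text \<open>The common cycle of \<open>Inc\<close>, \<open>Dec\<close> and the zero test:
  \<open>p\<close> is the first cell where the outcome is settled, and afterwards the head is back
  at cell 0, where the next instruction expects it.\<close>

lemma sweep:
  assumes "sweeps c r" "ih \<le> length x + 1" "2 ^ p \<le> D" "\<And>j. fst (tp j) \<longleftrightarrow> j = 0"
    and sweep_cell: "\<And>j. j < p \<Longrightarrow> snd (sweep_cell c (snd (tp j) r)) = None"
    and stop: "snd (sweep_cell c (snd (tp p) r)) = Some b"
    and fin: "finish h c ks b = (ks', d)"
    and tp': "\<And>j. tp' j = (if j \<le> p then upd (tp j) r (fst (sweep_cell c (snd (tp j) r))) else tp j)"
  shows "reach h x D ((c # ks, Go), ih, tp, 0, out) ((ks', Go), move ih d (length x + 1), tp', 0, out)"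
proof -
  let ?t = "\<lambda>j. if j < p then upd (tp j) r (fst (sweep_cell c (snd (tp j) r))) else tp j"
  let ?c = "((c # ks, Go), ih, ?t, p, out)"
  have "reach h x D ((c # ks, Go), ih, tp, 0, out) ?c"
    using assms by (intro sweep_forward) auto
  also have "reach h x D ?c (mstep h x ?c)" using assms(3) by (intro reach1) (simp add: whead_def)
  also have "mstep h x ?c = ((c # ks, Back b), ih, tp', p, out)"
  proof -
    have "delta h (c # ks, Go) y a = sweep_step c r ks a" for y a
      using assms(1) by (cases "(c, r)" rule: sweeps.cases) auto
    then show ?thesis
      using assms(2) stop by (auto simp: sweep_step_def fun_eq_iff tp' split: prod.splits option.splits)
  qed
  also have flag: "fst (tp' j) \<longleftrightarrow> j = 0" for j using assms(4) by (simp add: tp' upd_def)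
  then have "reach h x D ((c # ks, Back b), ih, tp', p, out) ((c # ks, Back b), ih, tp', 0, out)"
    using assms by (intro sweep_back) auto
  also have "1 \<le> (2 ^ p :: nat)" by simp
  with assms(3) have "1 \<le> D" by linarith
  then have "reach h x D ((c # ks, Back b), ih, tp', 0, out) (mstep h x ((c # ks, Back b), ih, tp', 0, out))"
    by (intro reach1) (simp add: whead_def)
  also have "mstep h x ((c # ks, Back b), ih, tp', 0, out) = ((ks', Go), move ih d (length x + 1), tp', 0, out)"
    using fin flag by auto
  finally show ?thesis .
qed

section \<open>Binary counters on the tracks\<close>

definition track :: "bool list \<Rightarrow> nat \<Rightarrow> bool option" where
  "track bs j = (if j < length bs then Some (bs ! j) else None)"

text \<open>Leading zeros are allowed, so the value does not determine the length of a track, which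
  needs its own bound; the factor 2 pays for the cell that a carry opens.\<close>

definition rep :: "nat \<Rightarrow> ('r \<Rightarrow> nat) \<Rightarrow> (nat \<Rightarrow> 'r cell) \<Rightarrow> bool" where
  "rep B s tp \<longleftrightarrow> (\<forall>j. fst (tp j) \<longleftrightarrow> j = 0) \<and>
     (\<forall>r. \<exists>bs. 2 ^ length bs \<le> 2 * B \<and> horner_sum of_bool 2 bs = s r \<and> (\<forall>j. snd (tp j) r = track bs j))"

lemma split_run: "\<exists>p rest. bs = replicate p b @ rest \<and> (rest = [] \<or> (\<exists>r. rest = (\<not> b) # r))"
proof (induction bs)
  case (Cons a bs)
  then obtain p rest where IH: "bs = replicate p b @ rest" "rest = [] \<or> (\<exists>r. rest = (\<not> b) # r)" by auto
  show ?case
  proof (cases "a = b")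
    case True
    then have "a # bs = replicate (Suc p) b @ rest" using IH by simp
    then show ?thesis using IH(2) by blast
  next
    case False
    then have "a # bs = replicate 0 b @ (\<not> b) # bs" by auto
    then show ?thesis by blast
  qed
qed auto

lemma horner_False: "horner_sum of_bool 2 (replicate p False @ bs) = (2 ^ p * horner_sum of_bool 2 bs :: nat)"
  by (induction p) auto

lemma horner_True: "horner_sum of_bool 2 (replicate p True @ bs) + 1 = (2 ^ p * (1 + horner_sum of_bool 2 bs) :: nat)"
  by (induction p) (auto simp: algebra_simps)

lemma rep_upd:
  assumes "rep B s tp" "2 ^ length bs \<le> 2 * B" "horner_sum of_bool 2 bs = n"
    and "\<And>j. tp' j = upd (tp j) r (track bs j)"
  shows "rep B (s(r := n)) tp'"
  using assms unfolding rep_def upd_def by auto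

lemma upd_same: "snd a r = v \<Longrightarrow> upd a r v = a"
  by (auto simp: upd_def)

lemma sim_Inc:
  assumes rep: "rep B s tp" and s: "s r < B" and ih: "ih \<le> length x + 1"
  shows "\<exists>tp'. rep B (s(r := Suc (s r))) tp' \<and>
    (\<forall>ks out. reach h x (2 * B) ((Inc r # ks, Go), ih, tp, 0, out)
      ((ks, Go), move ih (if r = h then 1 else 0) (length x + 1), tp', 0, out))"
proof -
  obtain bs where bs: "2 ^ length bs \<le> 2 * B" "horner_sum of_bool 2 bs = s r" "\<And>j. snd (tp j) r = track bs j"
    using rep unfolding rep_def by blast
  obtain p rest where p: "bs = replicate p True @ rest" "rest = [] \<or> (\<exists>r. rest = False # r)"
    using split_run[of bs True] by auto
  define bs' where "bs' = replicate p False @ True # tl rest"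
  define tp' where "tp' j = upd (tp j) r (track bs' j)" for j
  have val: "horner_sum of_bool 2 bs' = Suc (s r)"
    using p bs(2) horner_True[of p rest] by (auto simp: bs'_def horner_False)
  \<comment> \<open>The track grows only if all its bits are ones. Then the old value is
    \<open>2 ^ p - 1\<close> and below \<open>B\<close>, so \<open>p + 1\<close> bits are within the
    bound.\<close>
  have len: "2 ^ length bs' \<le> 2 * B"
  proof (cases "rest = []")
    case True
    then have "2 ^ p \<le> B" using horner_True[of p "[]"] p(1) bs(2) s by auto
    then show ?thesis using True by (simp add: bs'_def)
  next
    case False
    then show ?thesis using p bs(1) by (auto simp: bs'_def)
  qed
  have "2 ^ p \<le> (2 ^ length bs :: nat)" using p(1) by (intro power_increasing) auto
  then have D: "2 ^ p \<le> 2 * B" using bs(1) by linarith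
  have below: "track bs j = Some True" "track bs' j = Some False" if "j < p" for j
    using that p(1) by (auto simp: track_def bs'_def nth_append)
  have at: "track bs p \<noteq> Some True" "track bs' p = Some True"
    using p by (auto simp: track_def bs'_def nth_append)
  have above: "track bs' j = track bs j" if "j > p" for j
    using that p by (auto simp: track_def bs'_def nth_append nth_Cons split: nat.splits)
  have "tp' j = (if j \<le> p then upd (tp j) r (fst (sweep_cell (Inc r) (snd (tp j) r))) else tp j)" for j
  proof -
    consider "j < p" | "j = p" | "j > p" by linarith
    then show ?thesis
      using below[of j] at above[of j] bs(3)[of j] by cases (auto simp: tp'_def intro: upd_same)
  qed
  then have "reach h x (2 * B) ((Inc r # ks, Go), ih, tp, 0, out)
      ((ks, Go), move ih (if r = h then 1 else 0) (length x + 1), tp', 0, out)" for ks out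
    using rep D ih below at bs(3) by (intro sweep[where p = p and r = r and b = True]) (auto simp: rep_def)
  then show ?thesis using rep_upd[OF rep len val] tp'_def by blast
qed

lemma sim_Dec:
  assumes rep: "rep B s tp" and s: "0 < s r" and ih: "ih \<le> length x + 1"
  shows "\<exists>tp'. rep B (s(r := s r - 1)) tp' \<and>
    (\<forall>ks out. reach h x (2 * B) ((Dec r # ks, Go), ih, tp, 0, out)
      ((ks, Go), move ih (if r = h then -1 else 0) (length x + 1), tp', 0, out))"
proof -
  obtain bs where bs: "2 ^ length bs \<le> 2 * B" "horner_sum of_bool 2 bs = s r" "\<And>j. snd (tp j) r = track bs j"
    using rep unfolding rep_def by blast
  obtain p rest where p0: "bs = replicate p False @ rest" "rest = [] \<or> (\<exists>r. rest = True # r)"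
    using split_run[of bs False] by auto
  \<comment> \<open>A positive number has a one at which the borrow stops, so the length of the
    track does not change.\<close>
  have "rest \<noteq> []"
  proof
    assume "rest = []"
    then have "horner_sum of_bool 2 bs = (0 :: nat)" using p0(1) horner_False[of p "[]"] by simp
    then show False using bs(2) s by simp
  qed
  then obtain rs where p: "bs = replicate p False @ True # rs" using p0 by auto
  define bs' where "bs' = replicate p True @ False # rs"
  define tp' where "tp' j = upd (tp j) r (track bs' j)" for j
  have val: "horner_sum of_bool 2 bs' = s r - 1"
    using p bs(2) horner_True[of p "False # rs"] by (auto simp: bs'_def horner_False)
  have len: "2 ^ length bs' \<le> 2 * B" using p bs(1) by (auto simp: bs'_def)
  have "2 ^ p \<le> (2 ^ length bs :: nat)" using p(1) by (intro power_increasing) auto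
  then have D: "2 ^ p \<le> 2 * B" using bs(1) by linarith
  have below: "track bs j = Some False" "track bs' j = Some True" if "j < p" for j
    using that p(1) by (auto simp: track_def bs'_def nth_append)
  have at: "track bs p = Some True" "track bs' p = Some False"
    using p by (auto simp: track_def bs'_def nth_append)
  have above: "track bs' j = track bs j" if "j > p" for j
    using that p by (auto simp: track_def bs'_def nth_append nth_Cons split: nat.splits)
  have "tp' j = (if j \<le> p then upd (tp j) r (fst (sweep_cell (Dec r) (snd (tp j) r))) else tp j)" for j
  proof -
    consider "j < p" | "j = p" | "j > p" by linarith
    then show ?thesis
      using below[of j] at above[of j] bs(3)[of j] by cases (auto simp: tp'_def intro: upd_same)
  qed
  then have "reach h x (2 * B) ((Dec r # ks, Go), ih, tp, 0, out)
      ((ks, Go), move ih (if r = h then -1 else 0) (length x + 1), tp', 0, out)" for ks out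
    using rep D ih below at bs(3) by (intro sweep[where p = p and r = r and b = True]) (auto simp: rep_def)
  then show ?thesis using rep_upd[OF rep len val] tp'_def by blast
qed

lemma sim_Zero:
  assumes rep: "rep B s tp" and ih: "ih \<le> length x + 1"
  shows "reach h x (2 * B) ((Cond (Zero r) c d # ks, Go), ih, tp, 0, out)
      (((if s r = 0 then c else d) # ks, Go), ih, tp, 0, out)"
proof -
  obtain bs where bs: "2 ^ length bs \<le> 2 * B" "horner_sum of_bool 2 bs = s r" "\<And>j. snd (tp j) r = track bs j"
    using rep unfolding rep_def by blast
  obtain p rest where p: "bs = replicate p False @ rest" "rest = [] \<or> (\<exists>r. rest = True # r)"
    using split_run[of bs False] by auto
  have z: "s r = 0 \<longleftrightarrow> rest = []"
    using p bs(2) by (auto simp: horner_False)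
  have "2 ^ p \<le> (2 ^ length bs :: nat)" using p(1) by (intro power_increasing) auto
  then have D: "2 ^ p \<le> 2 * B" using bs(1) by linarith
  have below: "track bs j = Some False" if "j < p" for j
    using that p(1) by (auto simp: track_def nth_append)
  have at: "track bs p = (if rest = [] then None else Some True)"
    using p by (auto simp: track_def nth_append)
  have "reach h x (2 * B) ((Cond (Zero r) c d # ks, Go), ih, tp, 0, out)
      (((if s r = 0 then c else d) # ks, Go), move ih 0 (length x + 1), tp, 0, out)"
    using rep D ih below at bs(3) z
    by (intro sweep[where p = p and r = r and b = "rest = []"]) (auto simp: rep_def upd_same)
  then show ?thesis using ih by simp
qed

lemma sim_test:
  assumes rep: "rep B s tp" and ih: "s h \<le> length x + 1" and B: "0 < B"
  shows "reach h x (2 * B) ((Cond t c d # ks, Go), s h, tp, 0, out)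
      (((if holds h x t s then c else d) # ks, Go), s h, tp, 0, out)"
proof (cases t)
  case (Sym y)
  let ?c = "((Cond t c d # ks, Go), s h, tp, 0, out)"
  have "reach h x (2 * B) ?c (mstep h x ?c)" using B by (intro reach1) (simp add: whead_def)
  then show ?thesis using Sym ih by simp
qed (use sim_Zero[OF rep ih] in auto)

text \<open>The tape \<open>tp'\<close> depends neither on the remaining stack nor on the output so
  far, so the run of a subprogram can be put in front of any continuation, as \<open>Seq\<close> and
  \<open>Until\<close> require.\<close>

lemma sim:
  assumes "exec h x B c s s' w" "rep B s tp" "s h \<le> length x + 1" "0 < B"
  shows "s' h \<le> length x + 1 \<and> (\<exists>tp'. rep B s' tp' \<and>
    (\<forall>ks out. reach h x (2 * B) ((c # ks, Go), s h, tp, 0, out) ((ks, Go), s' h, tp', 0, out @ w)))"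
  using assms
proof (induction arbitrary: tp rule: exec.induct)
  case (Skip s)
  have "reach h x (2 * B) ((Skip # ks, Go), s h, tp, 0, out) (mstep h x ((Skip # ks, Go), s h, tp, 0, out))" for ks out
    using \<open>0 < B\<close> by (intro reach1) (simp add: whead_def)
  then show ?case using Skip by auto
next
  case (Out b s)
  have "reach h x (2 * B) ((Out b # ks, Go), s h, tp, 0, out) (mstep h x ((Out b # ks, Go), s h, tp, 0, out))" for ks out
    using \<open>0 < B\<close> by (intro reach1) (simp add: whead_def)
  then show ?case using Out by auto
next
  case (Inc s r)
  \<comment> \<open>The side condition of \<open>exec\<close> keeps the head within the end markers,
    so \<open>move\<close> does not clamp and the head agrees with its counter.\<close>
  have "move (s h) (if r = h then 1 else 0) (length x + 1) = (s(r := Suc (s r))) h"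
    using Inc by (auto simp: move_def)
  note eq = this
  have "(s(r := Suc (s r))) h \<le> length x + 1" using Inc by auto
  then show ?case using sim_Inc[OF Inc(3,1,4), of h] unfolding eq append_Nil2 by blast
next
  case (Dec s r)
  have "move (s h) (if r = h then -1 else 0) (length x + 1) = (s(r := s r - 1)) h"
    using Dec by (auto simp: move_def)
  note eq = this
  have "(s(r := s r - 1)) h \<le> length x + 1" using Dec by auto
  then show ?case using sim_Dec[OF Dec(2,1,3), of h] unfolding eq append_Nil2 by blast
next
  case (Seq c s s' v d s'' w)
  obtain tp1 where 1: "s' h \<le> length x + 1" "rep B s' tp1"
    "\<And>ks out. reach h x (2 * B) ((c # ks, Go), s h, tp, 0, out) ((ks, Go), s' h, tp1, 0, out @ v)"
    using Seq.IH(1)[OF Seq.prems] by auto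
  obtain tp2 where 2: "s'' h \<le> length x + 1" "rep B s'' tp2"
    "\<And>ks out. reach h x (2 * B) ((d # ks, Go), s' h, tp1, 0, out) ((ks, Go), s'' h, tp2, 0, out @ w)"
    using Seq.IH(2)[OF 1(2,1) \<open>0 < B\<close>] by auto
  have "reach h x (2 * B) ((Seq c d # ks, Go), s h, tp, 0, out) ((ks, Go), s'' h, tp2, 0, out @ v @ w)" for ks out
  proof -
    have "reach h x (2 * B) ((Seq c d # ks, Go), s h, tp, 0, out) (mstep h x ((Seq c d # ks, Go), s h, tp, 0, out))"
      using \<open>0 < B\<close> by (intro reach1) (simp add: whead_def)
    also have "mstep h x ((Seq c d # ks, Go), s h, tp, 0, out) = ((c # d # ks, Go), s h, tp, 0, out)"
      using Seq.prems by auto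
    also have "reach h x (2 * B) \<dots> ((d # ks, Go), s' h, tp1, 0, out @ v)" by (rule 1)
    also have "reach h x (2 * B) \<dots> ((ks, Go), s'' h, tp2, 0, (out @ v) @ w)" by (rule 2)
    finally show ?thesis by simp
  qed
  then show ?case using 2 by blast
next
  case (Cond t s c d s' w)
  obtain tp1 where 1: "s' h \<le> length x + 1" "rep B s' tp1"
    "\<And>ks out. reach h x (2 * B) (((if holds h x t s then c else d) # ks, Go), s h, tp, 0, out) ((ks, Go), s' h, tp1, 0, out @ w)"
    using Cond.IH[OF Cond.prems] by blast
  have "reach h x (2 * B) ((Cond t c d # ks, Go), s h, tp, 0, out) ((ks, Go), s' h, tp1, 0, out @ w)" for ks out
    using rtranclp_trans[OF sim_test[OF Cond.prems, of t c d ks out] 1(3)] .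
  then show ?case using 1 by blast
next
  case (Until_stop t s c)
  let ?c = "Cond t Skip (Seq c (Until t c))"
  have "reach h x (2 * B) ((Until t c # ks, Go), s h, tp, 0, out) ((ks, Go), s h, tp, 0, out @ [])" for ks out
  proof -
    have "reach h x (2 * B) ((Until t c # ks, Go), s h, tp, 0, out) (mstep h x ((Until t c # ks, Go), s h, tp, 0, out))"
      using \<open>0 < B\<close> by (intro reach1) (simp add: whead_def)
    also have "mstep h x ((Until t c # ks, Go), s h, tp, 0, out) = ((?c # ks, Go), s h, tp, 0, out)"
      using Until_stop by auto
    also have "reach h x (2 * B) \<dots> ((Skip # ks, Go), s h, tp, 0, out)"
      using sim_test[OF Until_stop.prems, of t] Until_stop.hyps by auto
    also have "reach h x (2 * B) ((Skip # ks, Go), s h, tp, 0, out) (mstep h x ((Skip # ks, Go), s h, tp, 0, out))"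
      using \<open>0 < B\<close> by (intro reach1) (simp add: whead_def)
    finally show ?thesis using Until_stop by auto
  qed
  then show ?case using Until_stop by blast
next
  case (Until_loop t s c s' v s'' w)
  let ?c = "Cond t Skip (Seq c (Until t c))"
  obtain tp1 where 1: "s' h \<le> length x + 1" "rep B s' tp1"
    "\<And>ks out. reach h x (2 * B) ((c # ks, Go), s h, tp, 0, out) ((ks, Go), s' h, tp1, 0, out @ v)"
    using Until_loop.IH(1)[OF Until_loop.prems] by blast
  obtain tp2 where 2: "s'' h \<le> length x + 1" "rep B s'' tp2"
    "\<And>ks out. reach h x (2 * B) ((Until t c # ks, Go), s' h, tp1, 0, out) ((ks, Go), s'' h, tp2, 0, out @ w)"
    using Until_loop.IH(2)[OF 1(2,1) \<open>0 < B\<close>] by blast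
  have "reach h x (2 * B) ((Until t c # ks, Go), s h, tp, 0, out) ((ks, Go), s'' h, tp2, 0, out @ v @ w)" for ks out
  proof -
    have "reach h x (2 * B) ((Until t c # ks, Go), s h, tp, 0, out) (mstep h x ((Until t c # ks, Go), s h, tp, 0, out))"
      using \<open>0 < B\<close> by (intro reach1) (simp add: whead_def)
    also have "mstep h x ((Until t c # ks, Go), s h, tp, 0, out) = ((?c # ks, Go), s h, tp, 0, out)"
      using Until_loop.prems by auto
    also have "reach h x (2 * B) \<dots> ((Seq c (Until t c) # ks, Go), s h, tp, 0, out)"
      using sim_test[OF Until_loop.prems, of t] Until_loop.hyps by auto
    also have "reach h x (2 * B) ((Seq c (Until t c) # ks, Go), s h, tp, 0, out)
        (mstep h x ((Seq c (Until t c) # ks, Go), s h, tp, 0, out))"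
      using \<open>0 < B\<close> by (intro reach1) (simp add: whead_def)
    also have "mstep h x ((Seq c (Until t c) # ks, Go), s h, tp, 0, out) = ((c # Until t c # ks, Go), s h, tp, 0, out)"
      using Until_loop.prems by auto
    also have "reach h x (2 * B) \<dots> ((Until t c # ks, Go), s' h, tp1, 0, out @ v)" by (rule 1)
    also have "reach h x (2 * B) \<dots> ((ks, Go), s'' h, tp2, 0, (out @ v) @ w)" by (rule 2)
    finally show ?thesis by simp
  qed
  then show ?case using 2 by blast
qed

text \<open>Covers every stack met while \<open>c\<close> runs above \<open>ks\<close>, until
  \<open>ks\<close> is exposed. The control is finite because an \<open>Until\<close> re-creates
  only itself on the same stack.\<close>

fun conts :: "'r com \<Rightarrow> 'r com list \<Rightarrow> 'r com list set" where
  "conts (Seq c d) ks = {Seq c d # ks} \<union> conts c (d # ks) \<union> conts d ks"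
| "conts (Cond t c d) ks = {Cond t c d # ks} \<union> conts c ks \<union> conts d ks"
| "conts (Until t c) ks = {Until t c # ks, Cond t Skip (Seq c (Until t c)) # ks, Skip # ks,
     Seq c (Until t c) # ks} \<union> conts c (Until t c # ks)"
| "conts c ks = {c # ks}"

fun nexts :: "'r com list \<Rightarrow> 'r com list set" where
  "nexts [] = {[]}"
| "nexts (Seq c d # ks) = {c # d # ks}"
| "nexts (Cond t c d # ks) = {c # ks, d # ks}"
| "nexts (Until t c # ks) = {Cond t Skip (Seq c (Until t c)) # ks}"
| "nexts (c # ks) = {ks}"

lemma conts_self: "c # ks \<in> conts c ks"
  by (cases c) auto

lemma finite_conts: "finite (conts c ks)"
  by (induction c ks rule: conts.induct) auto

lemma nexts_conts: "l \<in> conts c ks \<Longrightarrow> nexts l \<subseteq> insert ks (conts c ks)"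
proof (induction c ks rule: conts.induct)
  case (1 c d ks)
  then show ?case using conts_self[of c "d # ks"] conts_self[of d ks] by auto
next
  case (2 t c d ks)
  then show ?case using conts_self[of c ks] conts_self[of d ks] by auto
next
  case (3 t c ks)
  then show ?case using conts_self[of c "Until t c # ks"] by auto
qed auto

lemma delta_cont: "fst (fst (delta h (ks, p) y a)) \<in> insert ks (nexts ks)"
proof (cases "(h, (ks, p), y, a)" rule: delta.cases)
  case (2 h c ks b y a)
  then show ?thesis by (cases c) auto
qed (auto simp: sweep_step_def split: prod.splits option.splits)

lemma delta_moves:
  assumes "delta h q y a = (q', d, a', e, ob)"
  shows "d \<in> {-1, 0, 1} \<and> e \<in> {-1, 0, 1}"
  using assms
proof (cases "(h, q, y, a)" rule: delta.cases)
  case (2 h c ks b y a)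
  then show ?thesis using assms by (cases c) (auto split: if_splits)
qed (auto simp: sweep_step_def split: prod.splits option.splits)

lemma UNIV_phase: "UNIV = {Start, Go, Back True, Back False}"
proof -
  have "p \<in> {Start, Go, Back True, Back False}" for p by (cases p) auto
  then show ?thesis by blast
qed

instance phase :: finite
  by standard (simp add: UNIV_phase)

text \<open>A transducer tape starts filled with symbol 0, so the numbering of the cells must give 0
  to the empty cell.\<close>

lemma ex_coding_blank:
  assumes "finite A" "b \<in> A"
  shows "\<exists>g. bij_betw g A {..<card A} \<and> g b = (0::nat)"
proof -
  obtain g where g: "bij_betw g (A - {b}) {..<card (A - {b})}"
    using ex_bij_betw_finite_nat[of "A - {b}"] assms by (auto simp: atLeast0LessThan)
  define g' where "g' a = (if a = b then 0 else Suc (g a))" for a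
  have "bij_betw Suc {..<card (A - {b})} {0<..<Suc (card (A - {b}))}"
    by (auto simp: bij_betw_def image_Suc_lessThan)
  from bij_betw_trans[OF g this] have "bij_betw (Suc \<circ> g) (A - {b}) {0<..<card A}"
    using card_Suc_Diff1[OF assms] by simp
  then have "bij_betw g' (A - {b}) {0<..<card A}"
    by (subst bij_betw_cong[where g = "Suc \<circ> g"]) (auto simp: g'_def)
  then have "bij_betw g' (insert b (A - {b})) (insert 0 {0<..<card A})"
    by (intro bij_betw_combine[of g' "{b}" "{0}", simplified]) (auto simp: g'_def)
  moreover have "insert b (A - {b}) = A" "insert 0 {0<..<card A} = {..<card A}"
    using assms by (auto simp: card_gt_0_iff)
  ultimately show ?thesis by (auto simp: g'_def)
qed

text \<open>The machine is deterministic, so its iterates are the configurations on the path: each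
  one that is left obeys the bound by \<open>bstep\<close>, and the fixpoint at the end repeats
  forever.\<close>

lemma reach_bounded:
  assumes "reach h x D c c'" "mstep h x c' = c'" "2 ^ whead c' \<le> D"
  shows "(\<exists>n. (mstep h x ^^ n) c = c') \<and> (\<forall>n. 2 ^ whead ((mstep h x ^^ n) c) \<le> D)"
  using assms(1)
proof (induction rule: converse_rtranclp_induct)
  case base
  have "(mstep h x ^^ n) c' = c'" for n
    using assms(2) by (induction n) auto
  then show ?case using assms(3) by auto
next
  case (step c d)
  then have "d = mstep h x c" "2 ^ whead c \<le> D" by (auto simp: bstep_def)
  have "2 ^ whead ((mstep h x ^^ n) c) \<le> D" for n
    using step.IH \<open>2 ^ whead c \<le> D\<close> \<open>d = _\<close> by (cases n) (auto simp: funpow_swap1)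
  moreover obtain n where "(mstep h x ^^ n) d = c'" using step.IH by auto
  then have "(mstep h x ^^ Suc n) c = c'" using \<open>d = _\<close> by (simp add: funpow_swap1)
  ultimately show ?case by blast
qed

definition blank :: "'r cell" where "blank = (False, \<lambda>_. None)"

lemma run_program:
  assumes "exec h x B c (\<lambda>_. 0) s' w" "0 < B"
  shows "\<exists>ih tp. reach h x (2 * B) (([c], Start), 0, (\<lambda>_. blank), 0, []) (([], Go), ih, tp, 0, w)"
proof -
  let ?c0 = "(([c], Start), 0, (\<lambda>_. blank), 0, [])"
  let ?tp = "(\<lambda>_. blank)(0 := (True, snd blank))"
  have "rep B (\<lambda>_. 0) ?tp"
    using assms(2) by (auto simp: rep_def blank_def track_def intro!: exI[of _ "[]"])
  from sim[OF assms(1) this] assms(2) obtain tp where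
    "\<forall>ks out. reach h x (2 * B) ((c # ks, Go), 0, ?tp, 0, out) ((ks, Go), s' h, tp, 0, out @ w)"
    by auto
  from this[THEN spec, THEN spec, of "[]" "[]"]
  have "reach h x (2 * B) (([c], Go), 0, ?tp, 0, []) (([], Go), s' h, tp, 0, w)" by simp
  moreover have "reach h x (2 * B) ?c0 (mstep h x ?c0)"
    using assms(2) by (intro reach1) (simp add: whead_def)
  then have "reach h x (2 * B) ?c0 (([c], Go), 0, ?tp, 0, [])" by simp
  ultimately show ?thesis by (meson rtranclp_trans)
qed

text \<open>Renames the states and cells of the structured machine as numbers. There are finitely
  many cells because the register type is finite.\<close>

locale coding =
  fixes h :: "'r::finite" and c :: "'r com" and f :: "'r state \<Rightarrow> nat" and g :: "'r cell \<Rightarrow> nat"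
  assumes f: "bij_betw f (insert [] (conts c []) \<times> UNIV) {..<card (insert [] (conts c []) \<times> (UNIV::phase set))}"
    and g: "bij_betw g UNIV {..<card (UNIV :: 'r cell set)}" and g_blank: "g blank = 0"
begin

definition "Q = insert [] (conts c []) \<times> (UNIV :: phase set)"

definition T :: tdr where
  "T = \<lparr>t_nstates = card Q, t_nsyms = card (UNIV :: 'r cell set), t_start = f ([c], Start), t_halt = f ([], Go),
     t_delta = (\<lambda>q y a. case delta h (inv_into Q f q) y (inv_into UNIV g a) of
        (q', d, a', e, ob) \<Rightarrow> (f q', d, g a', e, ob))\<rparr>"

lemma t_halt_T: "t_halt T = f ([], Go)"
  by (simp add: T_def)

lemma f_less: "q \<in> Q \<Longrightarrow> f q < card Q"
  using f bij_betwE unfolding Q_def by blast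

lemma f_inv: "q \<in> Q \<Longrightarrow> inv_into Q f (f q) = q"
  using f unfolding Q_def by (simp add: bij_betw_inv_into_left)

lemma g_less: "g a < card (UNIV :: 'r cell set)"
  using g bij_betwE by blast

lemma g_inv: "inv_into UNIV g (g a) = a"
  using g by (simp add: bij_betw_inv_into_left)

lemma inv_Q: "n < card Q \<Longrightarrow> inv_into Q f n \<in> Q"
  using f unfolding Q_def by (intro inv_into_into) (auto simp: bij_betw_def)

lemma start_Q: "([c], Start) \<in> Q"
  using conts_self[of c "[]"] by (simp add: Q_def)

lemma halt_Q: "([], Go) \<in> Q"
  by (simp add: Q_def)

lemma delta_Q:
  assumes "q \<in> Q"
  shows "fst (delta h q y a) \<in> Q"
proof -
  obtain ks p where q: "q = (ks, p)" by (cases q)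
  have "nexts ks \<subseteq> insert [] (conts c [])"
    using assms nexts_conts[of ks c "[]"] by (auto simp: q Q_def)
  then have "fst (fst (delta h q y a)) \<in> insert [] (conts c [])"
    using delta_cont[of h ks p y a] assms by (auto simp: q Q_def)
  then show ?thesis by (cases "fst (delta h q y a)") (simp add: Q_def)
qed

lemma T_wf: "tdr_wf T"
proof -
  have "case t_delta T q y a of (q', d, a', e, out) \<Rightarrow>
           q' < t_nstates T \<and> a' < t_nsyms T \<and> d \<in> {-1, 0, 1} \<and> e \<in> {-1, 0, 1}"
    if "q < t_nstates T" for q y a
  proof -
    obtain q' d a' e ob where D: "delta h (inv_into Q f q) y (inv_into UNIV g a) = (q', d, a', e, ob)"
      by (metis prod.exhaust)
    have "q' \<in> Q" using delta_Q[OF inv_Q, of q y "inv_into UNIV g a"] that D by (simp add: T_def)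
    then show ?thesis using D delta_moves[OF D] f_less g_less by (simp add: T_def)
  qed
  moreover have "0 < card (UNIV :: 'r cell set)" by (simp add: card_gt_0_iff)
  ultimately show ?thesis
    using f_less[OF start_Q] f_less[OF halt_Q] unfolding tdr_wf_def by (auto simp: T_def)
qed

fun code :: "'r mconf \<Rightarrow> tconf" where
  "code (q, ih, tp, wh, out) = (f q, ih, g \<circ> tp, wh, out)"

lemma mstep_Q: "fst C \<in> Q \<Longrightarrow> fst (mstep h x C) \<in> Q"
proof (cases C)
  case (fields q ih tp wh out)
  assume "fst C \<in> Q"
  then show ?thesis using delta_Q[of q "inp x ih" "tp wh"] fields by (auto split: prod.splits)
qed

lemma tdr_step_code:
  assumes "fst C \<in> Q"
  shows "tdr_step T x (code C) = code (mstep h x C)"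
proof (cases C)
  case (fields q ih tp wh out)
  have "f q = f ([], Go) \<longleftrightarrow> q = ([], Go)"
    using assms fields f_inv halt_Q by (metis fst_conv)
  moreover have "g \<circ> (tp(i := a)) = (g \<circ> tp)(i := g a)" for i a by auto
  ultimately show ?thesis
    using assms fields by (auto simp: tdr_step_def T_def f_inv g_inv split: prod.splits)
qed

abbreviation "C0 \<equiv> (([c], Start), 0, (\<lambda>_. blank), 0, [])"

lemma iter_Q: "fst ((mstep h x ^^ t) C0) \<in> Q"
  by (induction t) (use start_Q mstep_Q in auto)

lemma tdr_conf_code: "tdr_conf T x t = code ((mstep h x ^^ t) C0)"
proof (induction t)
  case 0
  then show ?case by (auto simp: tdr_conf_def T_def g_blank)
next
  case (Suc t)
  have "tdr_conf T x (Suc t) = tdr_step T x (tdr_conf T x t)" by (simp add: tdr_conf_def)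
  then show ?case using Suc tdr_step_code[OF iter_Q] by simp
qed

lemma whead_code: "fst (snd (snd (snd (code C)))) = whead C"
  by (cases C) (simp add: whead_def)

lemma halt_code: "fst C \<in> Q \<Longrightarrow> fst (code C) = t_halt T \<longleftrightarrow> fst C = ([], Go)"
proof (cases C)
  case (fields q ih tp wh out)
  assume "fst C \<in> Q"
  then show ?thesis using fields f_inv halt_Q by (simp add: T_def) metis
qed

lemma reducible:
  assumes ex: "\<And>x. \<exists>s'. exec h x ((length x + 2) ^ K) c (\<lambda>_. 0) s' (F x)"
    and F: "\<And>x. x \<in> L \<longleftrightarrow> F x \<in> L'"
  shows "logspace_reducible L L'"
  unfolding logspace_reducible_def
proof (intro exI[of _ T] exI[of _ "real (K + 1)"] conjI allI impI)
  show "tdr_wf T" by (rule T_wf)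
  fix x :: "bool list"
  have B: "0 < (length x + 2) ^ K" by simp
  obtain s' where "exec h x ((length x + 2) ^ K) c (\<lambda>_. 0) s' (F x)" using ex by blast
  from run_program[OF this B] obtain ih tp where
    R: "reach h x (2 * (length x + 2) ^ K) C0 (([], Go), ih, tp, 0, F x)" by blast
  from reach_bounded[OF R] B
  obtain n where n: "(mstep h x ^^ n) C0 = (([], Go), ih, tp, 0, F x)"
    and bd: "\<And>n. 2 ^ whead ((mstep h x ^^ n) C0) \<le> 2 * (length x + 2) ^ K"
    by (auto simp: whead_def)
  show "\<exists>t. fst (tdr_conf T x t) = t_halt T"
    using n by (intro exI[of _ n]) (simp add: tdr_conf_code t_halt_T)
  fix t
  let ?w = "whead ((mstep h x ^^ t) C0)"
  have "real ?w = log 2 (real (2 ^ ?w))" by simp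
  also have "\<dots> \<le> log 2 (real (2 * (length x + 2) ^ K))"
    using bd[of t] by (subst log_le_cancel_iff) (auto simp del: of_nat_power of_nat_mult)
  also have "\<dots> = 1 + K * log 2 (real (length x) + 2)"
    by (simp add: log_mult log_nat_power add.commute)
  also have "1 \<le> log 2 (real (length x) + 2)" by simp
  finally show "real (fst (snd (snd (snd (tdr_conf T x t))))) \<le> real (K + 1) * log 2 (real (length x) + 2)"
    by (simp add: tdr_conf_code whead_code algebra_simps)
  assume "fst (tdr_conf T x t) = t_halt T"
  then have h: "fst ((mstep h x ^^ t) C0) = ([], Go)"
    using halt_code[OF iter_Q] by (simp add: tdr_conf_code)
  have stay: "(mstep h x ^^ m) C = C" if "fst C = ([], Go)" for m C
    using that by (induction m) (cases C; simp)+
  \<comment> \<open>Both configurations have halted and are fixed; continuing each up to time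
    \<open>t + n\<close> shows that every halting time gives the same output.\<close>
  have "(mstep h x ^^ t) C0 = (mstep h x ^^ n) ((mstep h x ^^ t) C0)" by (rule stay[OF h, symmetric])
  also have "\<dots> = (mstep h x ^^ t) ((mstep h x ^^ n) C0)"
    by (simp only: funpow_add[THEN fun_cong, unfolded comp_apply, symmetric] add.commute[of n])
  also have "\<dots> = (mstep h x ^^ n) C0" by (rule stay) (simp add: n)
  finally have "snd (snd (snd (snd (tdr_conf T x t)))) = F x"
    by (simp add: tdr_conf_code n)
  then show "x \<in> L \<longleftrightarrow> snd (snd (snd (snd (tdr_conf T x t)))) \<in> L'" using F by simp
qed

end

theorem logspace_reducibleI:
  fixes c :: "'r::finite com"
  assumes "\<And>x. \<exists>s'. exec h x ((length x + 2) ^ K) c (\<lambda>_. 0) s' (F x)"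
    and "\<And>x. x \<in> L \<longleftrightarrow> F x \<in> L'"
  shows "logspace_reducible L L'"
proof -
  let ?Q = "insert [] (conts c []) \<times> (UNIV :: phase set)"
  obtain f where f: "bij_betw f ?Q {..<card ?Q}"
    using ex_bij_betw_finite_nat[of ?Q] finite_conts[of c "[]"] by (auto simp: atLeast0LessThan)
  obtain g :: "'r cell \<Rightarrow> nat" where g: "bij_betw g UNIV {..<card (UNIV :: 'r cell set)}" "g blank = 0"
    using ex_coding_blank[of "UNIV :: 'r cell set" blank] by auto
  interpret coding h c f g by unfold_locales (use f g in auto)
  show ?thesis using reducible assms by blast
qed

section \<open>Encoding and evaluation of circuits\<close>

declare bin.simps [simp del]

lemma sym_bits_inj: "sym_bits a = sym_bits b \<Longrightarrow> a = b"
  by (cases a; cases b) simp_all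

lemma length_sym_bits [simp]: "length (sym_bits a) = 4"
  by (cases a) simp_all

lemma concat_sym_bits_inj:
  "concat (map sym_bits u) = concat (map sym_bits v) \<Longrightarrow> u = v"
proof (induction u arbitrary: v)
  case Nil
  then have "length (concat (map sym_bits v)) = 0" by simp
  then show ?case by (cases v) simp_all
next
  case (Cons a u)
  show ?case
  proof (cases v)
    case Nil
    then show ?thesis using arg_cong[OF Cons.prems, of length] by simp
  next
    case (Cons b v')
    then show ?thesis using Cons.prems Cons.IH[of v'] sym_bits_inj[of a b] by (auto simp: append_eq_append_conv)
  qed
qed

lemma bin_inj: "bin m = bin n \<Longrightarrow> m = n"
proof -
  have "foldl (\<lambda>v b. 2 * v + of_bool b) 0 (bin n) = n" for n :: nat
  proof (induction n rule: bin.induct)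
    case (1 n)
    then show ?case by (cases "n < 2") (auto simp: bin.simps[of n])
  qed
  then show "bin m = bin n \<Longrightarrow> m = n" by metis
qed

lemma set_enc_num: "set (enc_num n) \<subseteq> {D0, D1}"
  by (auto simp: enc_num_def)

lemma enc_num_inj: "enc_num m = enc_num n \<Longrightarrow> m = n"
proof -
  have "inj (\<lambda>b. if b then D1 else D0)" by (auto intro!: injI split: if_splits)
  then show "enc_num m = enc_num n \<Longrightarrow> m = n"
    unfolding enc_num_def by (metis bin_inj inj_map_eq_map)
qed

lemma set_enc_label: "set (enc_label l) \<inter> {Comma, Semi, Hash} = {}"
proof (cases l)
  case (In k)
  then show ?thesis using set_enc_num[of k] by auto
next
  case (Op f)
  then show ?thesis by (cases f) auto
qed

lemma enc_label_inj: "enc_label l = enc_label m \<Longrightarrow> l = m"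
proof (cases l; cases m)
  fix f g assume "enc_label l = enc_label m" "l = Op f" "m = Op g"
  then show ?thesis by (cases f; cases g) auto
next
  fix k g assume "enc_label l = enc_label m" "l = In k" "m = Op g"
  then show ?thesis using set_enc_num[of k] by (cases g) auto
next
  fix k g assume "enc_label l = enc_label m" "m = In k" "l = Op g"
  then show ?thesis using set_enc_num[of k] by (cases g) (auto dest: sym)
qed (auto dest: enc_num_inj)

lemma sep_inj:
  assumes "u @ c # v = u' @ c # v'" "c \<notin> set u" "c \<notin> set u'"
  shows "u = u' \<and> v = v'"
  using assms
proof (induction u arbitrary: u')
  case Nil
  then show ?case by (cases u') auto
next
  case (Cons a u)
  then show ?case by (cases u') auto
qed

definition enc_preds :: "nat list \<Rightarrow> sym list" where
  "enc_preds ps = concat (map (\<lambda>p. Comma # enc_num p) ps)"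

lemma set_enc_preds: "set (enc_preds ps) \<inter> {Semi, Hash} = {}"
proof -
  have "Semi \<notin> set (Comma # enc_num p)" "Hash \<notin> set (Comma # enc_num p)" for p
    using set_enc_num[of p] by auto
  then show ?thesis unfolding enc_preds_def by auto
qed

lemma digits_not: "Comma \<notin> set (enc_num p)" "Semi \<notin> set (enc_num p)" "Hash \<notin> set (enc_num p)"
  using set_enc_num[of p] by auto

text \<open>The field \<open>u\<close> ends at the first comma, or with the list if there are no
  predecessors.\<close>

lemma enc_field_inj:
  assumes "Comma \<notin> set u" "Comma \<notin> set u'" "u @ enc_preds ps = u' @ enc_preds qs"
  shows "u = u' \<and> enc_preds ps = enc_preds qs"
  using assms by (cases ps; cases qs) (auto simp: enc_preds_def dest: sep_inj split: list.splits)

lemma enc_preds_inj: "enc_preds ps = enc_preds qs \<Longrightarrow> ps = qs"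
proof (induction ps arbitrary: qs)
  case Nil
  then show ?case by (cases qs) (auto simp: enc_preds_def)
next
  case (Cons p ps)
  then obtain q qs' where qs: "qs = q # qs'" by (cases qs) (auto simp: enc_preds_def)
  then have "enc_num p @ enc_preds ps = enc_num q @ enc_preds qs'"
    using Cons.prems by (simp add: enc_preds_def)
  from enc_field_inj[OF digits_not(1) digits_not(1) this] show ?case
    using Cons.IH enc_num_inj qs by blast
qed

definition enc_body :: "gate \<Rightarrow> sym list" where
  "enc_body g = enc_num (gname g) @ Comma # enc_label (glabel g) @ enc_preds (gpreds g)"

lemma enc_gate_body: "enc_gate g = enc_body g @ [Semi]"
  by (simp add: enc_gate_def enc_body_def enc_preds_def)

lemma set_enc_body: "Semi \<notin> set (enc_body g)" "Hash \<notin> set (enc_body g)"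
  using set_enc_num[of "gname g"] set_enc_label[of "glabel g"] set_enc_preds[of "gpreds g"]
  by (auto simp: enc_body_def)

lemma enc_body_inj:
  assumes "enc_body g = enc_body g'"
  shows "g = g'"
proof -
  have 1: "enc_num (gname g) = enc_num (gname g')"
    "enc_label (glabel g) @ enc_preds (gpreds g) = enc_label (glabel g') @ enc_preds (gpreds g')"
    using sep_inj[OF assms[unfolded enc_body_def] digits_not(1) digits_not(1)] by auto
  have "Comma \<notin> set (enc_label l)" for l using set_enc_label[of l] by auto
  from enc_field_inj[OF this this 1(2)] show ?thesis
    using 1(1) enc_num_inj enc_label_inj enc_preds_inj
    by (metis gname_def glabel_def gpreds_def prod.collapse)
qed

text \<open>\<open>Semi\<close> closes every gate and \<open>Hash\<close> occurs in none, so the end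
  of the gate list can be recognised.\<close>

lemma enc_gates_inj:
  "concat (map enc_gate gs) @ Hash # u = concat (map enc_gate gs') @ Hash # v \<Longrightarrow> gs = gs' \<and> u = v"
proof (induction gs arbitrary: gs')
  case Nil
  show ?case
  proof (cases gs')
    case (Cons g gs'')
    have "Hash \<in> set (enc_body g) \<or> Hash = Semi"
      using Nil Cons by (cases "enc_body g") (auto simp: enc_gate_body)
    then show ?thesis using set_enc_body by simp
  qed (use Nil in auto)
next
  case (Cons g gs)
  show ?case
  proof (cases gs')
    case Nil
    have "Hash \<in> set (enc_body g) \<or> Hash = Semi"
      using Nil Cons.prems by (cases "enc_body g") (auto simp: enc_gate_body)
    then show ?thesis using set_enc_body by simp
  next
    case (Cons g' gs'')
    have "enc_body g @ Semi # concat (map enc_gate gs) @ Hash # u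
        = enc_body g' @ Semi # concat (map enc_gate gs'') @ Hash # v"
      using Cons Cons.prems enc_gate_body[of g] enc_gate_body[of g'] by simp
    from sep_inj[OF this set_enc_body(1) set_enc_body(1)] show ?thesis
      using Cons Cons.IH enc_body_inj by blast
  qed
qed

text \<open>\<open>MC\<close> is an image under the encoding; injectivity excludes that a string
  belongs to it through another circuit with the same code.\<close>

theorem enc_instance_inj:
  assumes "enc_instance gs b = enc_instance gs' b'"
  shows "gs = gs' \<and> b = b'"
proof -
  have "concat (map enc_gate gs) @ Hash # enc_num b = concat (map enc_gate gs') @ Hash # enc_num b'"
    using concat_sym_bits_inj[OF assms[unfolded enc_instance_def]] by simp
  then show ?thesis using enc_gates_inj enc_num_inj by blast
qed

lemma MC_iff: "enc_instance gs b \<in> MC Ops \<longleftrightarrow> wf_circuit Ops gs \<and> b \<in> circuit_val gs"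
  unfolding MC_def using enc_instance_inj by blast

text \<open>Predecessors occur later in the list, and no earlier gate reuses a later name. Hence the
  final valuation still holds the sets that a gate saw when it was evaluated.\<close>

lemma eval_gates_fixpoint:
  assumes "distinct (map gname gs)"
    and "\<And>i p. i < length gs \<Longrightarrow> p \<in> set (gpreds (gs ! i)) \<Longrightarrow> \<exists>j. i < j \<and> j < length gs \<and> gname (gs ! j) = p"
    and "g \<in> set gs"
  shows "eval_gates gs (gname g) = gate_val (glabel g) (map (eval_gates gs) (sort (gpreds g)))"
  using assms
proof (induction gs)
  case (Cons a gs)
  have tl: "\<exists>j. i < j \<and> j < length gs \<and> gname (gs ! j) = p"
    if "i < length gs" "p \<in> set (gpreds (gs ! i))" for i p
    using Cons.prems(2)[of "Suc i" p] that by (auto simp: less_Suc_eq_0_disj Suc_less_eq2)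
  have preds: "set (gpreds g) \<subseteq> gname ` set gs" 
  proof
    fix p assume p: "p \<in> set (gpreds g)"
    obtain i where "i < length (a # gs)" "(a # gs) ! i = g" using Cons.prems(3) by (metis in_set_conv_nth)
    then obtain j where "i < j" "j < length (a # gs)" "gname ((a # gs) ! j) = p"
      using Cons.prems(2)[of i p] p by blast
    then show "p \<in> gname ` set gs" by (cases j) auto
  qed
  have "eval_gates (a # gs) p = eval_gates gs p" if "p \<in> gname ` set gs" for p
  proof -
    have "gname a \<notin> gname ` set gs" using Cons.prems(1) by simp
    then have "p \<noteq> gname a" using that by metis
    then show ?thesis by (simp add: Let_def)
  qed
  then have "map (eval_gates (a # gs)) (sort (gpreds g)) = map (eval_gates gs) (sort (gpreds g))"
    using preds by auto
  moreover have "eval_gates (a # gs) (gname g) = gate_val (glabel g) (map (eval_gates gs) (sort (gpreds g)))"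
  proof (cases "g = a")
    case True
    then show ?thesis by (simp add: Let_def)
  next
    case False
    then have "g \<in> set gs" using Cons.prems(3) by simp
    moreover have "gname a \<notin> gname ` set gs" using Cons.prems(1) by simp
    ultimately have "gname g \<noteq> gname a" by (metis image_eqI)
    then show ?thesis using Cons.IH[OF _ tl \<open>g \<in> set gs\<close>] Cons.prems(1) by (simp add: Let_def)
  qed
  ultimately show ?case by (simp only:)
qed simp

lemma eval_wf_circuit:
  assumes "wf_circuit Ops gs" "g \<in> set gs"
  shows "eval_gates gs (gname g) = gate_val (glabel g) (map (eval_gates gs) (sort (gpreds g)))"
  using assms unfolding wf_circuit_def by (intro eval_gates_fixpoint) blast+

text \<open>\<open>ks\<close> assigns a key to every position. As it is sorted, a strictly larger
  key forces a later position, so the topological order can be checked on time levels instead of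
  list indices.\<close>

lemma wf_circuitI:
  assumes "gs \<noteq> []" "distinct (map gname gs)" "sorted ks" "length ks = length gs"
    and "\<And>i p. i < length gs \<Longrightarrow> p \<in> set (gpreds (gs ! i)) \<Longrightarrow>
      \<exists>j < length gs. ks ! i < ks ! j \<and> gname (gs ! j) = p"
    and "\<And>g. g \<in> set gs \<Longrightarrow> (case glabel g of
           In k \<Rightarrow> gpreds g = []
         | Op OCompl \<Rightarrow> length (gpreds g) = 1 \<and> OCompl \<in> Ops
         | Op f \<Rightarrow> length (gpreds g) = 2 \<and> f \<in> Ops)"
  shows "wf_circuit Ops gs"
proof -
  have "i < j" if "ks ! i < ks ! j" "i < length gs" for i j :: nat
    using that sorted_nth_mono[OF assms(3), of j i] assms(4) by (metis leD not_le_imp_less)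
  then show ?thesis unfolding wf_circuit_def using assms(1,2,5,6) by (metis nth_mem)
qed

section \<open>Program constructs\<close>

text \<open>A pair \<open>r\<close>, \<open>r'\<close> is a loop counter and what is left of its
  range: \<open>RU\<close> counts the time, \<open>RI\<close> is the input head, \<open>RA\<close>
  and \<open>RC\<close> are the looped parts of the left and right tape numbers. \<open>RX\<close>,
  \<open>RY\<close>, \<open>RZ\<close> are scratch registers.\<close>

datatype reg = RU | RU' | RI | RI' | RA | RA' | RC | RC' | RX | RY | RZ

lemma UNIV_reg: "UNIV = {RU, RU', RI, RI', RA, RA', RC, RC', RX, RY, RZ}"
proof -
  have "r \<in> {RU, RU', RI, RI', RA, RA', RC, RC', RX, RY, RZ}" for r by (cases r) auto
  then show ?thesis by blast
qed

instance reg :: finite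
  by standard (simp add: UNIV_reg)

abbreviation "bits w \<equiv> concat (map sym_bits w)"
abbreviation "run x B c s s' w \<equiv> exec RI x B c s s' (bits w)"

lemma run_Seq: "run x B c s s' v \<Longrightarrow> run x B d s' s'' w \<Longrightarrow> run x B (Seq c d) s s'' (v @ w)"
  by (simp add: exec.Seq)

lemma run_eq: "run x B c s s' w \<Longrightarrow> s' = t' \<Longrightarrow> w = v \<Longrightarrow> run x B c s t' v"
  by simp

lemma run_Inc: "s r < B \<Longrightarrow> r = RI \<longrightarrow> s r \<le> length x \<Longrightarrow> run x B (Inc r) s (s(r := Suc (s r))) []"
  by (simp add: exec.Inc del: fun_upd_apply)

lemma run_Dec: "0 < s r \<Longrightarrow> run x B (Dec r) s (s(r := s r - 1)) []"
  using exec.Dec[of s r RI x B] by simp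

lemma run_Until_stop: "holds RI x t s \<Longrightarrow> run x B (Until t c) s s []"
  by (simp add: exec.Until_stop)

lemma run_Until_loop: "\<not> holds RI x t s \<Longrightarrow> run x B c s s' v \<Longrightarrow> run x B (Until t c) s' s'' w
    \<Longrightarrow> run x B (Until t c) s s'' (v @ w)"
  by (simp add: exec.Until_loop)

lemma run_Cond: "run x B (if holds RI x t s then c else d) s s' w \<Longrightarrow> run x B (Cond t c d) s s' w"
  by (rule exec.Cond)

primrec seqs :: "'r com list \<Rightarrow> 'r com" where
  "seqs [] = Skip"
| "seqs (c # cs) = Seq c (seqs cs)"

lemma emit_seqs:
  assumes "\<And>k. k \<in> set ks \<Longrightarrow> run x B (f k) s s (w k)"
  shows "run x B (seqs (map f ks)) s s (concat (map w ks))"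
  using assms
proof (induction ks)
  case Nil
  then show ?case by (simp add: exec.Skip)
next
  case (Cons k ks)
  then show ?case using run_Seq[of x B "f k" s s "w k"] by simp
qed

lemma emit_seqs_Nil: "run x B (seqs []) s s []"
  by (simp add: exec.Skip)

lemma emit_seqs_Cons: "run x B c s s v \<Longrightarrow> run x B (seqs cs) s s w \<Longrightarrow> run x B (seqs (c # cs)) s s (v @ w)"
  by (simp add: exec.Seq)

definition outs :: "sym list \<Rightarrow> 'r com" where
  "outs w = seqs (map Out (bits w))"

lemma run_outs: "run x B (outs w) s s w"
proof -
  have "exec RI x B (seqs (map Out bs)) s s bs" for bs
  proof (induction bs)
    case (Cons b bs)
    then show ?case using exec.Seq[OF exec.Out Cons.IH] by fastforce
  qed (auto intro: exec.Skip)
  then show ?thesis by (simp add: outs_def)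
qed

lemma run_Incs:
  assumes "distinct rs" "\<And>r. r \<in> set rs \<Longrightarrow> s r < B" "RI \<in> set rs \<longrightarrow> s RI \<le> length x"
  shows "run x B (seqs (map Inc rs)) s (\<lambda>q. if q \<in> set rs then Suc (s q) else s q) []"
  using assms
proof (induction rs arbitrary: s)
  case Nil
  then show ?case by (simp add: exec.Skip)
next
  case (Cons r rs)
  let ?s = "s(r := Suc (s r))"
  have 1: "run x B (Inc r) s ?s []" using Cons.prems by (intro run_Inc) auto
  have 2: "run x B (seqs (map Inc rs)) ?s (\<lambda>q. if q \<in> set rs then Suc (?s q) else ?s q) []"
    using Cons.prems by (intro Cons.IH) auto
  have "run x B (Seq (Inc r) (seqs (map Inc rs))) s (\<lambda>q. if q \<in> set rs then Suc (?s q) else ?s q) ([] @ [])"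
    by (rule run_Seq[OF 1 2])
  then show ?case
    unfolding list.map(2) seqs.simps by (rule run_eq) (use Cons.prems(1) in \<open>auto simp: fun_eq_iff\<close>)
qed

text \<open>Registers change by unit steps only, so reading one empties it. Addition, copying and
  printing are all this loop; a value survives by being parked in another register.\<close>

definition transfer :: "'r \<Rightarrow> 'r list \<Rightarrow> sym list \<Rightarrow> 'r com" where
  "transfer r rs w = Until (Zero r) (Seq (Dec r) (Seq (seqs (map Inc rs)) (outs w)))"

lemma run_transfer:
  assumes "distinct rs" "r \<notin> set rs" "\<And>q. q \<in> set rs \<Longrightarrow> s q + s r \<le> B"
    and "RI \<in> set rs \<longrightarrow> s RI + s r \<le> Suc (length x)"
  shows "run x B (transfer r rs w) s (\<lambda>q. if q = r then 0 else if q \<in> set rs then s q + s r else s q)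
    (concat (replicate (s r) w))"
  using assms(3,4)
proof (induction "s r" arbitrary: s)
  case 0
  then show ?case
    unfolding transfer_def by (intro run_eq[OF run_Until_stop]) (auto simp: fun_eq_iff)
next
  case (Suc n)
  let ?s = "s(r := s r - 1)"
  let ?s' = "\<lambda>q. if q \<in> set rs then Suc (?s q) else ?s q"
  have s'r: "?s' r = n" using Suc.hyps assms(2) by auto
  have 1: "run x B (Dec r) s ?s []" using Suc.hyps by (intro run_Dec) simp
  have lt: "s q < B" if "q \<in> set rs" for q
    using Suc.prems(1)[OF that] Suc.hyps(2) by linarith
  have 2: "run x B (seqs (map Inc rs)) ?s ?s' []"
    using Suc lt assms(1,2) by (intro run_Incs) auto
  have 3: "run x B (Seq (Dec r) (Seq (seqs (map Inc rs)) (outs w))) s ?s' ([] @ [] @ w)"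
    by (intro run_Seq[OF 1] run_Seq[OF 2] run_outs)
  have 4: "run x B (transfer r rs w) ?s' (\<lambda>q. if q = r then 0 else if q \<in> set rs then ?s' q + ?s' r else ?s' q)
    (concat (replicate (?s' r) w))"
    using Suc assms(2) by (intro Suc.hyps(1)) (auto simp del: fun_upd_apply simp: s'r[symmetric], auto)
  have "\<not> holds RI x (Zero r) s" using Suc.hyps by simp
  from run_Until_loop[OF this 3 4[unfolded transfer_def]]
  show ?case unfolding transfer_def
    by (rule run_eq) (use Suc.hyps(2)[symmetric] assms(2) in \<open>auto simp: fun_eq_iff\<close>)
qed

text \<open>The value is parked in \<open>RZ\<close> and moved back, so printing leaves the
  registers as they were.\<close>

definition emit :: "nat \<Rightarrow> reg \<Rightarrow> reg com" where
  "emit n r = Seq (transfer r [RZ] (replicate n D1)) (transfer RZ [r] [])"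

definition ok :: "bool list \<Rightarrow> nat \<Rightarrow> (reg \<Rightarrow> nat) \<Rightarrow> bool" where
  "ok x B s \<longleftrightarrow> (\<forall>r. s r \<le> B) \<and> s RI \<le> Suc (length x) \<and> s RZ = 0"

lemma run_emit:
  assumes "ok x B s" "r \<noteq> RZ"
  shows "run x B (emit n r) s s (replicate (n * s r) D1)"
proof -
  let ?s1 = "\<lambda>q. if q = r then 0 else if q \<in> set [RZ] then s q + s r else s q"
  have 1: "run x B (transfer r [RZ] (replicate n D1)) s ?s1 (concat (replicate (s r) (replicate n D1)))"
    using assms by (intro run_transfer) (auto simp: ok_def)
  have 2: "run x B (transfer RZ [r] []) ?s1
    (\<lambda>q. if q = RZ then 0 else if q \<in> set [r] then ?s1 q + ?s1 RZ else ?s1 q) (concat (replicate (?s1 RZ) []))"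
    using assms by (intro run_transfer) (auto simp: ok_def)
  have "concat (replicate m (replicate n D1)) = replicate (n * m) D1" for m
    by (induction m) (auto simp: replicate_add)
  moreover have "concat (replicate m []) = []" for m by (induction m) auto
  ultimately show ?thesis
    unfolding emit_def
    by (intro run_eq[OF run_Seq[OF 1 2]]) (use assms in \<open>auto simp: fun_eq_iff ok_def\<close>)
qed

text \<open>The loop runs over \<open>r = 0, \<dots>, N\<close>, and \<open>r'\<close> holds \<open>N - r\<close>, so no bound has to be copied or compared.\<close>

definition For :: "reg \<Rightarrow> reg \<Rightarrow> reg com \<Rightarrow> reg com" where
  "For r r' c = Seq c (Seq (Until (Zero r') (Seq (Inc r) (Seq (Dec r') c))) (transfer r [r'] []))"

text \<open>For \<open>r = RI\<close> the loop carries the input head across the tape, and the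
  closing \<open>transfer\<close> takes it back to the left marker.\<close>

lemma run_For:
  assumes s: "s r = 0" "s r' = N" and r: "r \<noteq> r'" "r' \<noteq> RI" and N: "N \<le> B" "r = RI \<longrightarrow> N \<le> Suc (length x)"
    and body: "\<And>j. j \<le> N \<Longrightarrow> run x B c (s(r := j, r' := N - j)) (s(r := j, r' := N - j)) (w j)"
  shows "run x B (For r r' c) s s (concat (map w [0..<Suc N]))"
proof -
  let ?s = "\<lambda>j. s(r := j, r' := N - j)"
  let ?c = "Until (Zero r') (Seq (Inc r) (Seq (Dec r') c))"
  have s0: "?s 0 = s" using s r by auto
  have loop: "run x B ?c (?s (N - n)) (?s N) (concat (map w [Suc (N - n)..<Suc N]))" if "n \<le> N" for n
    using that
  proof (induction n)
    case 0
    have "run x B ?c (?s N) (?s N) []" by (rule run_Until_stop) simp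
    then show ?case by (simp del: fun_upd_apply)
  next
    case (Suc n)
    let ?j = "N - Suc n"
    have j: "Suc ?j = N - n" using Suc.prems by simp
    have "run x B (Inc r) (?s ?j) ((?s ?j)(r := Suc (?s ?j r))) []"
      using r N Suc.prems by (intro run_Inc) auto
    then have 1: "run x B (Inc r) (?s ?j) ((?s ?j)(r := N - n)) []"
      using r j by simp
    have "run x B (Dec r') ((?s ?j)(r := N - n)) (((?s ?j)(r := N - n))(r' := ((?s ?j)(r := N - n)) r' - 1)) []"
      using r Suc.prems by (intro run_Dec) auto
    then have 2: "run x B (Dec r') ((?s ?j)(r := N - n)) (?s (N - n)) []"
      by (rule run_eq) (use r Suc.prems in \<open>auto simp: fun_eq_iff\<close>)
    have 3: "run x B (Seq (Inc r) (Seq (Dec r') c)) (?s ?j) (?s (N - n)) ([] @ [] @ w (N - n))"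
      by (intro run_Seq[OF 1] run_Seq[OF 2] body) simp
    have "\<not> holds RI x (Zero r') (?s ?j)" using Suc.prems by simp
    moreover have "[Suc ?j..<Suc N] = (N - n) # [Suc (N - n)..<Suc N]"
      unfolding j by (rule upt_conv_Cons) simp
    ultimately show ?case
      by (intro run_eq[OF run_Until_loop[OF _ 3 Suc.IH[OF Suc_leD[OF Suc.prems]]]]) (simp_all del: upt_Suc)
  qed
  have 1: "run x B c s s (w 0)" using body[of 0] s0 by simp
  have 2: "run x B ?c s (?s N) (concat (map w [Suc 0..<Suc N]))" using loop[of N] s0 by simp
  have "run x B (transfer r [r'] []) (?s N)
     (\<lambda>q. if q = r then 0 else if q \<in> set [r'] then ?s N q + ?s N r else ?s N q) (concat (replicate (?s N r) []))"
    using r N by (intro run_transfer) auto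
  moreover have "concat (replicate m []) = []" for m by (induction m) auto
  ultimately have 3: "run x B (transfer r [r'] []) (?s N) s []"
    by (elim run_eq) (use r s in \<open>auto simp: fun_eq_iff\<close>)
  have "map w [0..<Suc N] = w 0 # map w [Suc 0..<Suc N]" by (simp add: upt_conv_Cons del: upt_Suc)
  then show ?thesis
    unfolding For_def by (intro run_eq[OF run_Seq[OF 1 run_Seq[OF 2 3]]]) auto
qed

abbreviation field :: "nat \<Rightarrow> sym list" where "field v \<equiv> replicate v D1 @ [D0]"

text \<open>Unary addition is concatenation, so an affine function of the registers is printed term
  by term and never computed.\<close>

definition lin :: "(nat \<times> reg) list \<Rightarrow> nat \<Rightarrow> reg com" where
  "lin ts n = Seq (seqs (map (\<lambda>(k, r). emit k r) ts)) (outs (field n))"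

lemma run_lin:
  assumes "ok x B s" "RZ \<notin> snd ` set ts" "v = (\<Sum>(k, r)\<leftarrow>ts. k * s r) + n"
  shows "run x B (lin ts n) s s (field v)"
proof -
  have "run x B (seqs (map (\<lambda>(k, r). emit k r) ts)) s s (concat (map (\<lambda>(k, r). replicate (k * s r) D1) ts))"
  proof (rule emit_seqs)
    fix t assume "t \<in> set ts"
    then have "snd t \<noteq> RZ" using assms(2) by force
    from run_emit[OF assms(1) this]
    show "run x B (case t of (k, r) \<Rightarrow> emit k r) s s (case t of (k, r) \<Rightarrow> replicate (k * s r) D1)"
      by (cases t) simp
  qed
  moreover have "concat (map (\<lambda>(k, r). replicate (k * s r) D1) ts) = replicate (\<Sum>(k, r)\<leftarrow>ts. k * s r) D1"
    by (induction ts) (auto simp: replicate_add)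
  ultimately show ?thesis
    unfolding lin_def assms(3) by (intro run_eq[OF run_Seq[OF _ run_outs]]) (auto simp: replicate_add)
qed

text \<open>The left marker also reads as \<open>None\<close>, so the head leaves it before
  searching for the right one, at position \<open>length x + 1\<close>.\<close>

definition scan_prog :: "reg com" where
  "scan_prog = Seq (Inc RI) (Seq (Until (Sym None) (Inc RI)) (transfer RI [RI'] []))"

lemma run_scan_prog:
  assumes "Suc (length x) \<le> B"
  shows "run x B scan_prog (\<lambda>_. 0) ((\<lambda>_. 0)(RI' := Suc (length x))) []"
proof -
  let ?s = "\<lambda>j. (\<lambda>_. 0)(RI := j) :: reg \<Rightarrow> nat"
  have "run x B (Inc RI) (\<lambda>_. 0) ((\<lambda>_. 0)(RI := Suc ((\<lambda>_. 0) RI))) []"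
    using assms by (intro run_Inc) auto
  then have 1: "run x B (Inc RI) (\<lambda>_. 0) (?s 1) []" by simp
  have "run x B (Until (Sym None) (Inc RI)) (?s (Suc (length x) - n)) (?s (Suc (length x))) []"
    if "n \<le> length x" for n
    using that
  proof (induction n)
    case 0
    show ?case unfolding diff_zero by (rule run_Until_stop) (simp add: inp_def)
  next
    case (Suc n)
    let ?j = "Suc (length x) - Suc n"
    have "run x B (Inc RI) (?s ?j) ((?s ?j)(RI := Suc (?s ?j RI))) []"
      using assms Suc.prems by (intro run_Inc) auto
    then have "run x B (Inc RI) (?s ?j) (?s (Suc (length x) - n)) []"
      by (rule run_eq) (use Suc.prems in \<open>auto simp: Suc_diff_le\<close>)
    note 1 = this
    show ?case
      by (rule run_eq[OF run_Until_loop[OF _ 1 Suc.IH]]) (use Suc.prems in \<open>auto simp: inp_def\<close>)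
  qed
  from this[of "length x"]
  have 2: "run x B (Until (Sym None) (Inc RI)) (?s 1) (?s (Suc (length x))) []" by simp
  have "run x B (transfer RI [RI'] []) (?s (Suc (length x)))
     (\<lambda>q. if q = RI then 0 else if q \<in> set [RI'] then ?s (Suc (length x)) q + ?s (Suc (length x)) RI else ?s (Suc (length x)) q)
      (concat (replicate (?s (Suc (length x)) RI) []))"
    using assms by (intro run_transfer) auto
  moreover have "concat (replicate m []) = []" for m by (induction m) auto
  ultimately have 3: "run x B (transfer RI [RI'] []) (?s (Suc (length x))) ((\<lambda>_. 0)(RI' := Suc (length x))) []"
    by (elim run_eq) (auto simp: fun_eq_iff)
  show ?thesis
    unfolding scan_prog_def by (rule run_eq[OF run_Seq[OF 1 run_Seq[OF 2 3]]]) simp_all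
qed

text \<open>\<open>RI'\<close> holds \<open>length x + 1\<close>; the \<open>Inc RY\<close> of each
  round supplies the missing one of the factor \<open>length x + 2\<close>.\<close>

definition mult_prog :: "reg com" where
  "mult_prog = Seq (Until (Zero RX) (Seq (Dec RX) (Seq (Inc RY) (Seq (transfer RI' [RZ, RY] []) (transfer RZ [RI'] [])))))
     (transfer RY [RX] [])"

lemma run_mult_prog:
  assumes s: "s RI' = Suc (length x)" "s RY = 0" "s RZ = 0" and B: "s RX * (length x + 2) \<le> B" "length x + 2 \<le> B"
  shows "run x B mult_prog s (s(RX := s RX * (length x + 2))) []"
proof -
  let ?c = "Seq (Dec RX) (Seq (Inc RY) (Seq (transfer RI' [RZ, RY] []) (transfer RZ [RI'] [])))"
  have nil: "concat (replicate m []) = []" for m :: nat by (induction m) auto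
  have "run x B (Until (Zero RX) ?c) (s(RX := n, RY := m)) (s(RX := 0, RY := m + n * (length x + 2))) []"
    if "m + n * (length x + 2) \<le> B" for n m
    using that
  proof (induction n arbitrary: m)
    case 0
    show ?case by (rule run_eq[OF run_Until_stop]) auto
  next
    case (Suc n)
    let ?s0 = "s(RX := Suc n, RY := m)"
    let ?s1 = "s(RX := n, RY := m)"
    let ?s2 = "s(RX := n, RY := Suc m)"
    let ?s3 = "s(RX := n, RY := m + (length x + 2), RI' := 0, RZ := Suc (length x))"
    let ?s4 = "s(RX := n, RY := m + (length x + 2))"
    have 1: "run x B (Dec RX) ?s0 ?s1 []" by (rule run_eq[OF run_Dec]) auto
    have 2: "run x B (Inc RY) ?s1 ?s2 []" using Suc.prems by (intro run_eq[OF run_Inc]) auto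
    have 3: "run x B (transfer RI' [RZ, RY] []) ?s2 ?s3 []"
      using Suc.prems s B by (intro run_eq[OF run_transfer]) (auto simp: nil fun_eq_iff)
    have 4: "run x B (transfer RZ [RI'] []) ?s3 ?s4 []"
      using Suc.prems s B by (intro run_eq[OF run_transfer]) (auto simp: nil fun_eq_iff)
    have 5: "run x B ?c ?s0 ?s4 ([] @ [] @ [] @ [])"
      by (intro run_Seq[OF 1] run_Seq[OF 2] run_Seq[OF 3 4])
    show ?case
      by (rule run_eq[OF run_Until_loop[OF _ 5 Suc.IH]]) (use Suc.prems in \<open>auto simp: algebra_simps\<close>)
  qed
  from this[of 0 "s RX"] B s
  have 1: "run x B (Until (Zero RX) ?c) s (s(RX := 0, RY := s RX * (length x + 2))) []"
    by (metis fun_upd_triv add_0)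
  have 2: "run x B (transfer RY [RX] []) (s(RX := 0, RY := s RX * (length x + 2))) (s(RX := s RX * (length x + 2))) []"
    using s B by (intro run_eq[OF run_transfer]) (auto simp: nil fun_eq_iff)
  show ?thesis unfolding mult_prog_def using run_Seq[OF 1 2] by simp
qed

definition power_prog :: "nat \<Rightarrow> reg com" where
  "power_prog k = Seq (Inc RX) (seqs (replicate k mult_prog))"

lemma run_power_prog:
  assumes s: "s RI' = Suc (length x)" "s RX = 0" "s RY = 0" "s RZ = 0"
    and B: "(length x + 2) ^ k \<le> B" "length x + 2 \<le> B"
  shows "run x B (power_prog k) s (s(RX := (length x + 2) ^ k)) []"
proof -
  let ?n = "length x + 2"
  have loop: "run x B (seqs (replicate j mult_prog)) (s(RX := v)) (s(RX := v * ?n ^ j)) []" if "v * ?n ^ j \<le> B" for j v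
    using that
  proof (induction j arbitrary: v)
    case 0
    show ?case unfolding replicate_0 by (rule run_eq[OF emit_seqs_Nil]) simp_all
  next
    case (Suc j)
    have "v * ?n * 1 \<le> v * ?n * ?n ^ j" by (intro mult_left_mono) auto
    also have "\<dots> \<le> B" using Suc.prems by (simp only: power_Suc mult.assoc)
    finally have "v * ?n \<le> B" by simp
    then have 1: "run x B mult_prog (s(RX := v)) (s(RX := v * ?n)) []"
      using s B by (intro run_eq[OF run_mult_prog]) auto
    have 2: "run x B (seqs (replicate j mult_prog)) (s(RX := v * ?n)) (s(RX := v * ?n * ?n ^ j)) []"
      using Suc.prems by (intro Suc.IH) (simp only: power_Suc mult.assoc)
    show ?case unfolding replicate_Suc seqs.simps
      by (rule run_eq[OF run_Seq[OF 1 2]]) (simp_all only: power_Suc mult.assoc append_Nil)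
  qed
  have 1: "run x B (Inc RX) s (s(RX := 1)) []" using s B by (intro run_eq[OF run_Inc]) auto
  show ?thesis unfolding power_prog_def
    by (rule run_eq[OF run_Seq[OF 1 loop[of 1 k]]]) (use B(1) in simp_all)
qed

definition init_prog :: "nat \<Rightarrow> nat \<Rightarrow> reg com" where
  "init_prog k K = Seq scan_prog (Seq (power_prog k) (Seq (transfer RX [RU'] []) (Seq (power_prog K) (transfer RX [RA', RC'] []))))"

lemma run_init_prog:
  assumes "k \<le> K" "1 \<le> K"
  shows "run x ((length x + 2) ^ K) (init_prog k K) (\<lambda>_. 0)
    ((\<lambda>_. 0)(RI' := Suc (length x), RU' := (length x + 2) ^ k, RA' := (length x + 2) ^ K, RC' := (length x + 2) ^ K)) []"
proof -
  let ?n = "length x + 2" let ?B = "?n ^ K"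
  let ?s = "(\<lambda>_. 0)(RI' := Suc (length x)) :: reg \<Rightarrow> nat"
  have nil: "concat (replicate m []) = []" for m :: nat by (induction m) auto
  have "?n ^ 1 \<le> ?B" using assms by (intro power_increasing) auto
  then have n: "?n \<le> ?B" by simp
  have k: "?n ^ k \<le> ?B" using assms by (intro power_increasing) auto
  have 1: "run x ?B scan_prog (\<lambda>_. 0) ?s []" using n by (intro run_scan_prog) simp
  have 2: "run x ?B (power_prog k) ?s (?s(RX := ?n ^ k)) []" using n k by (intro run_power_prog) auto
  have 3: "run x ?B (transfer RX [RU'] []) (?s(RX := ?n ^ k)) (?s(RU' := ?n ^ k)) []"
    using k by (intro run_eq[OF run_transfer]) (auto simp: nil fun_eq_iff)
  have 4: "run x ?B (power_prog K) (?s(RU' := ?n ^ k)) (?s(RU' := ?n ^ k, RX := ?B)) []"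
    using n by (intro run_eq[OF run_power_prog]) auto
  have 5: "run x ?B (transfer RX [RA', RC'] []) (?s(RU' := ?n ^ k, RX := ?B)) (?s(RU' := ?n ^ k, RA' := ?B, RC' := ?B)) []"
    by (intro run_eq[OF run_transfer]) (auto simp: nil fun_eq_iff)
  show ?thesis
    unfolding init_prog_def by (rule run_eq[OF run_Seq[OF 1 run_Seq[OF 2 run_Seq[OF 3 run_Seq[OF 4 5]]]]]) simp_all
qed

section \<open>The circuit of a probabilistic machine and the program that prints it\<close>

text \<open>The start value 1 is a leading digit that keeps blocks of value 0 from being lost as
  leading zeros.\<close>

definition gate_name :: "nat list \<Rightarrow> nat" where
  "gate_name fs = foldl (\<lambda>v b. 2 * v + of_bool b) 1 (concat (map (\<lambda>v. replicate v True @ [False]) fs))"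

lemma foldl_bits_bounds:
  "2 ^ length bs \<le> foldl (\<lambda>v b. 2 * v + of_bool b) (1::nat) bs \<and>
   foldl (\<lambda>v b. 2 * v + of_bool b) (1::nat) bs < 2 ^ Suc (length bs)"
  by (induction bs rule: rev_induct) auto

lemma bin_foldl_bits: "bin (foldl (\<lambda>v b. 2 * v + of_bool b) 1 bs) = True # bs"
proof (induction bs rule: rev_induct)
  case Nil
  then show ?case by (simp add: bin.simps)
next
  case (snoc b bs)
  let ?v = "foldl (\<lambda>v b. 2 * v + of_bool b) (1::nat) bs"
  have "1 \<le> (2 ^ length bs :: nat)" by simp
  then have "1 \<le> ?v" using foldl_bits_bounds[of bs] by linarith
  then have "bin (2 * ?v + of_bool b) = bin ?v @ [b]"
    by (subst bin.simps) auto
  then show ?case using snoc by simp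
qed

lemma enc_num_gate_name: "enc_num (gate_name fs) = D1 # concat (map field fs)"
proof -
  have "map (\<lambda>b. if b then D1 else D0) (concat (map (\<lambda>v. replicate v True @ [False]) fs)) = concat (map field fs)"
    by (induction fs) auto
  then show ?thesis unfolding enc_num_def gate_name_def bin_foldl_bits by simp
qed

lemma fields_code_inj: "concat (map field fs) = concat (map field gs) \<Longrightarrow> fs = gs"
proof (induction fs arbitrary: gs)
  case Nil
  then show ?case by (cases gs) auto
next
  case (Cons v fs)
  then obtain u gs' where gs: "gs = u # gs'" by (cases gs) auto
  have "replicate v D1 @ D0 # concat (map field fs) = replicate u D1 @ D0 # concat (map field gs')"
    using Cons.prems gs by simp
  from sep_inj[OF this] have "replicate v D1 = replicate u D1" "concat (map field fs) = concat (map field gs')"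
    by auto
  then show ?case using Cons.IH gs by (metis length_replicate)
qed

lemma gate_name_inj: "gate_name fs = gate_name gs \<longleftrightarrow> fs = gs"
  using fields_code_inj enc_num_gate_name by (metis list.inject)

text \<open>After the leading digit, a name has one bit per unit and one per field, and more bits
  mean a larger number. This settles which gate becomes the divisor.\<close>

lemma gate_name_less:
  assumes "sum_list fs + length fs < sum_list gs + length gs"
  shows "gate_name fs < gate_name gs"
proof -
  let ?b = "\<lambda>fs. concat (map (\<lambda>v. replicate v True @ [False]) fs)"
  have len: "length (?b fs) = sum_list fs + length fs" for fs by (induction fs) auto
  have "gate_name fs < 2 ^ Suc (length (?b fs))" unfolding gate_name_def using foldl_bits_bounds by blast
  also have "\<dots> \<le> 2 ^ length (?b gs)" using assms unfolding len by (intro power_increasing) auto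
  also have "\<dots> \<le> gate_name gs" unfolding gate_name_def using foldl_bits_bounds by blast
  finally show ?thesis .
qed

text \<open>With six fields a name is at least 64, which leaves the small names to the
  header.\<close>

lemma gate_name_ge: "2 ^ length fs \<le> gate_name fs"
proof -
  let ?b = "\<lambda>fs. concat (map (\<lambda>v. replicate v True @ [False]) fs)"
  have "length (?b fs) = sum_list fs + length fs" for fs by (induction fs) auto
  then have "(2::nat) ^ length fs \<le> 2 ^ length (?b fs)" by (intro power_increasing) auto
  also have "\<dots> \<le> gate_name fs" unfolding gate_name_def using foldl_bits_bounds by blast
  finally show ?thesis .
qed

lemma concat_map_product:
  "concat (map (\<lambda>x. concat (map (f x) ys)) xs) = concat (map (\<lambda>(x, y). f x y) (List.product xs ys))"
  by (induction xs) (auto simp: comp_def)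

locale reduction =
  fixes M :: ptm
  assumes M: "ptm_wf M"
begin

abbreviation "Q \<equiv> p_nstates M"
abbreviation "b \<equiv> Suc (p_nsyms M)"

text \<open>Extends \<open>p_delta\<close> to everything enumerated: halted states, the dummy state
  \<open>Q\<close> and the digit \<open>p_nsyms M\<close>, which is no symbol, stand still.\<close>

definition trans :: "nat \<Rightarrow> bool option \<Rightarrow> nat \<Rightarrow> bool \<Rightarrow> nat \<times> int \<times> nat \<times> int" where
  "trans q y a coin = (if q < Q \<and> q \<noteq> p_acc M \<and> q \<noteq> p_rej M \<and> a < p_nsyms M
     then p_delta M q y a coin else (q, 0, a, 0))"

text \<open>The last conjunct ensures that \<open>Suc a'\<close> is a digit in base \<open>b\<close>
  when a right move pushes it onto the left number.\<close>

lemma trans_range: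
  assumes "trans q y a coin = (q', d, a', e)"
  shows "d \<in> {-1, 0, 1} \<and> e \<in> {-1, 0, 1} \<and> (q \<le> Q \<longrightarrow> q' \<le> Q) \<and> (a < b \<longrightarrow> a' < b) \<and> (e \<noteq> 0 \<longrightarrow> a' < p_nsyms M)"
proof (cases "q < Q \<and> q \<noteq> p_acc M \<and> q \<noteq> p_rej M \<and> a < p_nsyms M")
  case True
  then have "p_delta M q y a coin = (q', d, a', e)" using assms by (simp add: trans_def)
  moreover have "case p_delta M q y a coin of (q', d, a', e) \<Rightarrow>
      q' < p_nstates M \<and> a' < p_nsyms M \<and> d \<in> {-1, 0, 1} \<and> e \<in> {-1, 0, 1}"
    using M True by (simp add: ptm_wf_def)
  ultimately show ?thesis by auto
qed (use assms in \<open>auto simp: trans_def\<close>)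

text \<open>
  A configuration at time \<open>u\<close> is \<open>(q, a, u, i, L, R)\<close> with scanned symbol \<open>a\<close>, input head at \<open>i\<close>, and the tape
  left and right of the work head as numbers \<open>L\<close>, \<open>R\<close> whose lowest digit is the cell next to the head.
  Digits of \<open>L\<close> are symbols plus one, so that \<open>L mod b = 0\<close> detects the left end of the tape.
\<close>

definition succ :: "bool list \<Rightarrow> bool \<Rightarrow> nat \<times> nat \<times> nat \<times> nat \<times> nat \<times> nat \<Rightarrow> nat list" where
  "succ x coin = (\<lambda>(q, a, u, i, L, R). case trans q (inp x i) a coin of (q', d, a', e) \<Rightarrow>
     let i' = move i d (length x + 1) in
     if e = 1 then [q', R mod b, Suc u, i', L * b + Suc a', R div b]
     else if e = -1 \<and> L mod b \<noteq> 0 then [q', L mod b - 1, Suc u, i', L div b, R * b + a']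
     else [q', a', Suc u, i', L, R])"

definition leaf :: "nat \<Rightarrow> nat" where
  "leaf q = (if q = p_acc M then 4 else if q = Q then 2 else 1)"

text \<open>The first case only concerns unreachable configurations; it keeps successors inside the enumerated range.\<close>

definition gate :: "bool list \<Rightarrow> nat \<Rightarrow> nat \<Rightarrow> nat \<times> nat \<times> nat \<times> nat \<times> nat \<times> nat \<Rightarrow> gate" where
  "gate x T X = (\<lambda>(q, a, u, i, L, R).
     (gate_name [q, a, u, i, L, R],
      if L div b > X \<or> R div b > X then (In 1, [])
      else if T \<le> u then (In (leaf q), [])
      else (Op OTimes, [gate_name (succ x True (q, a, u, i, L, R)), gate_name (succ x False (q, a, u, i, L, R))])))"

text \<open>The predecessors are sorted by name before a division: 3 is below 4, and the dummy state
  \<open>Q\<close> exceeds the start state, so the dividend comes first each time.\<close>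

definition header :: "gate list" where
  "header = [(1, Op ODiv, [2, 2]), (2, Op ODiv, [3, 4]),
     (3, Op ODiv, [gate_name [p_start M, 0, 0, 0, 0, 0], gate_name [Q, 0, 0, 0, 0, 0]]), (4, In 2, [])]"

text \<open>These ranges do not depend on the input, so the tuples
  \<open>(q, a, l, hl, r, hr)\<close> are unrolled in the program text instead of being looped
  over.\<close>

definition digit_choices :: "(nat \<times> nat \<times> nat \<times> nat \<times> nat \<times> nat) list" where
  "digit_choices = List.product [0..<Suc Q] (List.product [0..<b] (List.product [0..<b] (List.product [0..<b]
     (List.product [0..<b] [0..<b]))))"

text \<open>
  Numbers below \<open>Suc X * b * b\<close> are split as \<open>(hl * Suc X + m) * b + l\<close>: the overflow test of \<open>gate\<close> becomes
  \<open>0 < hl\<close> and the popped digit becomes \<open>l\<close>, both known when the program is written, and only \<open>m\<close> is a loop counter.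
\<close>

definition tuple_at :: "nat \<Rightarrow> nat \<times> nat \<times> nat \<times> nat \<times> nat \<times> nat \<times> nat \<times> nat \<times> nat \<times> nat
    \<Rightarrow> nat \<times> nat \<times> nat \<times> nat \<times> nat \<times> nat" where
  "tuple_at X = (\<lambda>(u, i, m, k, q, a, l, hl, r, hr).
     (q, a, u, i, (hl * Suc X + m) * b + l, (hr * Suc X + k) * b + r))"

text \<open>Time is the outermost coordinate, so predecessors, which belong to the next time step,
  come further down the list.\<close>

definition tuples :: "bool list \<Rightarrow> nat \<Rightarrow> nat \<Rightarrow> (nat \<times> nat \<times> nat \<times> nat \<times> nat \<times> nat) list" where
  "tuples x T X = map (tuple_at X) (List.product [0..<Suc T] (List.product [0..<Suc (length x + 1)]
     (List.product [0..<Suc X] (List.product [0..<Suc X] digit_choices))))"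

definition circuit :: "bool list \<Rightarrow> nat \<Rightarrow> nat \<Rightarrow> gate list" where
  "circuit x T X = header @ map (gate x T X) (tuples x T X)"

section \<open>Printing the gates\<close>

definition name_prog :: "nat \<Rightarrow> nat \<Rightarrow> nat \<Rightarrow> reg com \<Rightarrow> (nat \<times> reg) list \<Rightarrow> nat \<Rightarrow> (nat \<times> reg) list \<Rightarrow> nat \<Rightarrow> reg com" where
  "name_prog q a du hp Ls Lc Rs Rc =
     seqs [outs [D1], lin [] q, lin [] a, lin [(1, RU)] du, hp, lin Ls Lc, lin Rs Rc]"

text \<open>The flags \<open>lo\<close> and \<open>hi\<close> tell that the head is at an end, where
  \<open>move\<close> clamps. A difference cannot be printed by concatenation, so for a left move
  the register itself is lowered and restored.\<close>

definition head_prog :: "int \<Rightarrow> bool \<Rightarrow> bool \<Rightarrow> reg com" where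
  "head_prog d lo hi = (if d = 1 then lin [(1, RI)] (if hi then 0 else 1)
     else if d = -1 then (if lo then lin [] 0 else Seq (Dec RI) (Seq (lin [(1, RI)] 0) (Inc RI)))
     else lin [(1, RI)] 0)"

text \<open>Without overflow the left number is \<open>RA * b + l\<close>: a push gives
  \<open>RA\<close> the coefficient \<open>b * b\<close>, and a pop leaves \<open>RA\<close> alone.
  The right number behaves likewise.\<close>

definition succ_prog :: "bool \<Rightarrow> bool option \<Rightarrow> bool \<Rightarrow> bool \<Rightarrow> nat \<Rightarrow> nat \<Rightarrow> nat \<Rightarrow> nat \<Rightarrow> reg com" where
  "succ_prog coin y lo hi q a l r = (case trans q y a coin of (q', d, a', e) \<Rightarrow>
     if e = 1 then name_prog q' r 1 (head_prog d lo hi) [(b * b, RA)] (l * b + Suc a') [(1, RC)] 0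
     else if e = -1 \<and> l \<noteq> 0 then name_prog q' (l - 1) 1 (head_prog d lo hi) [(1, RA)] 0 [(b * b, RC)] (r * b + a')
     else name_prog q' a' 1 (head_prog d lo hi) [(b, RA)] l [(b, RC)] r)"

definition times_prog :: "nat \<Rightarrow> nat \<Rightarrow> nat \<Rightarrow> nat \<Rightarrow> bool option \<Rightarrow> bool \<Rightarrow> bool \<Rightarrow> reg com" where
  "times_prog q a l r y lo hi = seqs [outs [Comma, ST, Comma], succ_prog True y lo hi q a l r,
     outs [Comma], succ_prog False y lo hi q a l r, outs [Semi]]"

text \<open>Both end markers read as \<open>None\<close>; the zero test on \<open>RI\<close> tells
  them apart.\<close>

definition input_case :: "(bool option \<Rightarrow> bool \<Rightarrow> bool \<Rightarrow> reg com) \<Rightarrow> reg com" where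
  "input_case p = Cond (Zero RI) (p None True False) (Cond (Sym None) (p None False True)
     (Cond (Sym (Some True)) (p (Some True) False False) (p (Some False) False False)))"

lemma run_input_case:
  assumes "exec RI x B (p (inp x (s RI)) (s RI = 0) (s RI = Suc (length x))) s s' w" "s RI \<le> Suc (length x)"
  shows "exec RI x B (input_case p) s s' w"
proof -
  consider "s RI = 0" | "s RI = Suc (length x)" | v where "0 < s RI" "s RI \<le> length x" "inp x (s RI) = Some v"
    using assms(2) by (cases "s RI = 0"; cases "s RI = Suc (length x)") (auto simp: inp_def)
  then show ?thesis
  proof cases
    case (3 v)
    then show ?thesis using assms(1) by (cases v) (auto simp: input_case_def intro!: exec.Cond)
  qed (use assms(1) in \<open>auto simp: input_case_def inp_def intro!: exec.Cond\<close>)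
qed

text \<open>\<open>Suc X\<close> is not known to the program text. The coefficients come from
  writing it as \<open>RA + RA' + 1\<close>, or \<open>RC + RC' + 1\<close>, and multiplying out.
  \<open>RU' = 0\<close> says that the final time is reached.\<close>

definition gate_prog :: "nat \<times> nat \<times> nat \<times> nat \<times> nat \<times> nat \<Rightarrow> reg com" where
  "gate_prog = (\<lambda>(q, a, l, hl, r, hr). seqs
     [name_prog q a 0 (lin [(1, RI)] 0)
        [(b * Suc hl, RA), (b * hl, RA')] (b * hl + l) [(b * Suc hr, RC), (b * hr, RC')] (b * hr + r),
      if 0 < hl \<or> 0 < hr then outs [Comma, D1, Semi]
      else Cond (Zero RU') (outs ([Comma] @ enc_num (leaf q) @ [Semi]))
        (input_case (times_prog q a l r))])"

definition main_prog :: "nat \<Rightarrow> nat \<Rightarrow> reg com" where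
  "main_prog k K = Seq (init_prog k K) (seqs [outs (concat (map enc_gate header)),
     For RU RU' (For RI RI' (For RA RA' (For RC RC' (seqs (map gate_prog digit_choices))))),
     outs (Hash # enc_num 1)])"

lemma run_name_prog:
  assumes "ok x B s" "run x B hp s s (field i)"
    and "RZ \<notin> snd ` set Ls" "L = (\<Sum>(k, r)\<leftarrow>Ls. k * s r) + Lc"
    and "RZ \<notin> snd ` set Rs" "R = (\<Sum>(k, r)\<leftarrow>Rs. k * s r) + Rc"
    and "u = s RU + du"
  shows "run x B (name_prog q a du hp Ls Lc Rs Rc) s s (enc_num (gate_name [q, a, u, i, L, R]))"
  unfolding name_prog_def
  by (rule run_eq[OF emit_seqs_Cons[OF run_outs emit_seqs_Cons[OF run_lin[OF assms(1)] emit_seqs_Cons[OF run_lin[OF assms(1)]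
    emit_seqs_Cons[OF run_lin[OF assms(1)] emit_seqs_Cons[OF assms(2) emit_seqs_Cons[OF run_lin[OF assms(1,3,4)]
    emit_seqs_Cons[OF run_lin[OF assms(1,5,6)] emit_seqs_Nil]]]]]]]])
    (use assms(7) in \<open>auto simp: enc_num_gate_name\<close>)

lemma run_head_prog:
  assumes ok: "ok x B s" and d: "d \<in> {-1, 0, 1}" and lo: "lo \<longleftrightarrow> s RI = 0" and hi: "hi \<longleftrightarrow> s RI = Suc (length x)"
    and B: "Suc (length x) \<le> B"
  shows "run x B (head_prog d lo hi) s s (field (move (s RI) d (length x + 1)))"
proof -
  have i: "s RI \<le> Suc (length x)" using ok by (simp add: ok_def)
  consider "d = 1" | "d = 0" | "d = -1" "s RI = 0" | "d = -1" "s RI > 0" using d by auto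
  then show ?thesis
  proof cases
    case 4
    let ?s = "s(RI := s RI - 1)"
    have m: "move (s RI) d (length x + 1) = s RI - 1" using 4 i by (auto simp: move_def)
    have 1: "run x B (Dec RI) s ?s []" using 4 by (intro run_Dec)
    have "ok x B ?s" using ok unfolding ok_def by (auto intro: le_trans[OF diff_le_self])
    then have 2: "run x B (lin [(1, RI)] 0) ?s ?s (field (s RI - 1))"
      by (rule run_lin) auto
    have 3: "run x B (Inc RI) ?s s []" by (rule run_eq[OF run_Inc]) (use 4 i B in auto)
    have "head_prog d lo hi = Seq (Dec RI) (Seq (lin [(1, RI)] 0) (Inc RI))" using 4 lo by (simp add: head_prog_def)
    then show ?thesis unfolding m by (simp only:) (rule run_eq[OF run_Seq[OF 1 run_Seq[OF 2 3]]], simp_all)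
  next
    case 1
    have m: "move (s RI) d (length x + 1) = s RI + (if hi then 0 else 1)"
      using 1 i hi by (auto simp: move_def)
    have "run x B (lin [(1, RI)] (if hi then 0 else 1)) s s (field (move (s RI) d (length x + 1)))"
      by (rule run_lin[OF ok]) (use m in simp_all)
    moreover have "head_prog d lo hi = lin [(1, RI)] (if hi then 0 else 1)" using 1 by (simp add: head_prog_def)
    ultimately show ?thesis by (simp only:)
  next
    case 2
    have m: "move (s RI) d (length x + 1) = s RI" using 2 i by simp
    have "run x B (lin [(1, RI)] 0) s s (field (move (s RI) d (length x + 1)))"
      by (rule run_lin[OF ok]) (use m in simp_all)
    moreover have "head_prog d lo hi = lin [(1, RI)] 0" using 2 by (simp add: head_prog_def)
    ultimately show ?thesis by (simp only:)
  next
    case 3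
    have m: "move (s RI) d (length x + 1) = 0" using 3 by (simp add: move_def)
    have "run x B (lin [] 0) s s (field (move (s RI) d (length x + 1)))"
      by (rule run_lin[OF ok]) (use m in simp_all)
    moreover have "head_prog d lo hi = lin [] 0" using 3 lo by (simp add: head_prog_def)
    ultimately show ?thesis by (simp only:)
  qed
qed

lemma run_succ_prog:
  assumes ok: "ok x B s" and lo: "lo \<longleftrightarrow> s RI = 0" and hi: "hi \<longleftrightarrow> s RI = Suc (length x)"
    and B: "Suc (length x) \<le> B" and y: "y = inp x (s RI)" and lr: "l < b" "r < b"
  shows "run x B (succ_prog coin y lo hi q a l r) s s
    (enc_num (gate_name (succ x coin (q, a, s RU, s RI, s RA * b + l, s RC * b + r))))"
proof -
  obtain q' d a' e where D: "trans q y a coin = (q', d, a', e)" by (metis prod.exhaust)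
  have d: "d \<in> {-1, 0, 1}" using trans_range[OF D] by simp
  note h = run_head_prog[OF ok d lo hi B]
  have L: "(s RA * b + l) div b = s RA" "(s RA * b + l) mod b = l"
    "(s RC * b + r) div b = s RC" "(s RC * b + r) mod b = r"
    using lr by (simp_all only: div_mult_self3 mod_mult_self3 div_less mod_less)
  let ?i = "move (s RI) d (length x + 1)"
  have S: "succ x coin (q, a, s RU, s RI, s RA * b + l, s RC * b + r) =
     (if e = 1 then [q', r, Suc (s RU), ?i, (s RA * b + l) * b + Suc a', s RC]
      else if e = -1 \<and> l \<noteq> 0 then [q', l - 1, Suc (s RU), ?i, s RA, (s RC * b + r) * b + a']
      else [q', a', Suc (s RU), ?i, s RA * b + l, s RC * b + r])"
    by (simp only: succ_def prod.case D Let_def y[symmetric] L)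
  consider "e = 1" | "e = -1" "l \<noteq> 0" | "e \<noteq> 1" "\<not> (e = -1 \<and> l \<noteq> 0)" by blast
  then show ?thesis
  proof cases
    case 1
    have P: "succ_prog coin y lo hi q a l r
        = name_prog q' r 1 (head_prog d lo hi) [(b * b, RA)] (l * b + Suc a') [(1, RC)] 0"
      using 1 by (simp add: succ_prog_def D)
    show ?thesis unfolding P S if_P[OF 1] by (rule run_name_prog[OF ok h]) (simp_all add: algebra_simps)
  next
    case 2
    have P: "succ_prog coin y lo hi q a l r
        = name_prog q' (l - 1) 1 (head_prog d lo hi) [(1, RA)] 0 [(b * b, RC)] (r * b + a')"
      using 2 by (simp add: succ_prog_def D)
    have S': "succ x coin (q, a, s RU, s RI, s RA * b + l, s RC * b + r)
        = [q', l - 1, Suc (s RU), ?i, s RA, (s RC * b + r) * b + a']"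
      unfolding S using 2 by simp
    show ?thesis unfolding P S' by (rule run_name_prog[OF ok h]) (simp_all add: algebra_simps)
  next
    case 3
    have P: "succ_prog coin y lo hi q a l r
        = name_prog q' a' 1 (head_prog d lo hi) [(b, RA)] l [(b, RC)] r"
      using 3 by (auto simp: succ_prog_def D)
    have S': "succ x coin (q, a, s RU, s RI, s RA * b + l, s RC * b + r)
        = [q', a', Suc (s RU), ?i, s RA * b + l, s RC * b + r]"
      unfolding S using 3 by auto
    show ?thesis unfolding P S' by (rule run_name_prog[OF ok h]) (simp_all add: algebra_simps)
  qed
qed

lemma run_times_prog:
  assumes ok: "ok x B s" and lo: "lo \<longleftrightarrow> s RI = 0" and hi: "hi \<longleftrightarrow> s RI = Suc (length x)"
    and B: "Suc (length x) \<le> B" and y: "y = inp x (s RI)" and lr: "l < b" "r < b"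
  shows "run x B (times_prog q a l r y lo hi) s s
    ([Comma, ST, Comma] @ enc_num (gate_name (succ x True (q, a, s RU, s RI, s RA * b + l, s RC * b + r))) @ [Comma] @
     enc_num (gate_name (succ x False (q, a, s RU, s RI, s RA * b + l, s RC * b + r))) @ [Semi])"
  unfolding times_prog_def
  by (rule run_eq[OF emit_seqs_Cons[OF run_outs emit_seqs_Cons[OF run_succ_prog[OF assms]
    emit_seqs_Cons[OF run_outs emit_seqs_Cons[OF run_succ_prog[OF assms] emit_seqs_Cons[OF run_outs emit_seqs_Nil]]]]]]) auto

lemma run_gate_prog:
  assumes ok: "ok x B s" and B: "Suc (length x) \<le> B"
    and s: "s RU + s RU' = T" "s RA + s RA' = X" "s RC + s RC' = X"
    and c: "c \<in> set digit_choices"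
  shows "run x B (gate_prog c) s s (enc_gate (gate x T X (tuple_at X (s RU, s RI, s RA, s RC, c))))"
proof -
  obtain q a l hl r hr where c': "c = (q, a, l, hl, r, hr)" by (metis prod.exhaust)
  have lr: "l < b" "r < b" using c by (auto simp: digit_choices_def c')
  let ?L = "(hl * Suc X + s RA) * b + l" and ?R = "(hr * Suc X + s RC) * b + r"
  have div: "?L div b = hl * Suc X + s RA" "?R div b = hr * Suc X + s RC"
    using lr by (simp_all only: div_mult_self3) auto
  have big: "n * Suc X + m > X \<longleftrightarrow> 0 < n" if "m \<le> X" for n m
    using that by (cases n) auto
  have gt: "X < ?L div b \<longleftrightarrow> 0 < hl" "X < ?R div b \<longleftrightarrow> 0 < hr"
    unfolding div using big s by auto
  let ?t = "(q, a, s RU, s RI, ?L, ?R)"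
  have LR1: "?L = (\<Sum>(k, r)\<leftarrow>[(b * Suc hl, RA), (b * hl, RA')]. k * s r) + (b * hl + l)"
    unfolding s(2)[symmetric] by (simp add: algebra_simps)
  have LR2: "?R = (\<Sum>(k, r)\<leftarrow>[(b * Suc hr, RC), (b * hr, RC')]. k * s r) + (b * hr + r)"
    unfolding s(3)[symmetric] by (simp add: algebra_simps)
  have name: "run x B (name_prog q a 0 (lin [(1, RI)] 0)
        [(b * Suc hl, RA), (b * hl, RA')] (b * hl + l) [(b * Suc hr, RC), (b * hr, RC')] (b * hr + r)) s s
      (enc_num (gate_name [q, a, s RU, s RI, ?L, ?R]))"
    by (rule run_name_prog[OF ok run_lin[OF ok] _ LR1 _ LR2]) simp_all
  have rest: "run x B (if 0 < hl \<or> 0 < hr then outs [Comma, D1, Semi]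
      else Cond (Zero RU') (outs ([Comma] @ enc_num (leaf q) @ [Semi]))
        (input_case (times_prog q a l r))) s s
    ([Comma] @ enc_label (fst (snd (gate x T X ?t))) @ enc_preds (snd (snd (gate x T X ?t))) @ [Semi])"
  proof (cases "0 < hl \<or> 0 < hr")
    case True
    then have G: "gate x T X ?t = (gate_name [q, a, s RU, s RI, ?L, ?R], In 1, [])"
      unfolding gate_def using gt by simp
    show ?thesis
      unfolding if_P[OF True] G
      by (rule run_eq[OF run_outs]) (simp_all add: enc_preds_def enc_num_def bin.simps)
  next
    case False
    show ?thesis
    proof (cases "s RU' = 0")
      case True
      then have G: "gate x T X ?t = (gate_name [q, a, s RU, s RI, ?L, ?R], In (leaf q), [])"
        unfolding gate_def using gt False s by auto
      have H: "holds RI x (Zero RU') s" using True by simp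
      show ?thesis
        unfolding if_not_P[OF False] G
        by (rule run_Cond, unfold if_P[OF H], rule run_eq[OF run_outs]) (simp_all add: enc_preds_def)
    next
      case U: False
      have LR: "?L = s RA * b + l" "?R = s RC * b + r" using False by auto
      have G: "gate x T X ?t = (gate_name [q, a, s RU, s RI, ?L, ?R], Op OTimes,
          [gate_name (succ x True (q, a, s RU, s RI, s RA * b + l, s RC * b + r)),
           gate_name (succ x False (q, a, s RU, s RI, s RA * b + l, s RC * b + r))])"
        unfolding gate_def using gt False U s(1) by auto
      have H: "\<not> holds RI x (Zero RU') s" using U by simp
      have "run x B (input_case (times_prog q a l r)) s s
        ([Comma, ST, Comma] @ enc_num (gate_name (succ x True (q, a, s RU, s RI, s RA * b + l, s RC * b + r))) @ [Comma] @
          enc_num (gate_name (succ x False (q, a, s RU, s RI, s RA * b + l, s RC * b + r))) @ [Semi])"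
        using ok by (intro run_input_case run_times_prog[OF ok refl refl B refl lr]) (simp add: ok_def)
      then show ?thesis
        unfolding if_not_P[OF False] G
        by (intro run_Cond, unfold if_not_P[OF H], elim run_eq) (simp_all add: enc_preds_def)
    qed
  qed
  have "enc_gate (gate x T X ?t) = enc_num (gate_name [q, a, s RU, s RI, ?L, ?R]) @
      [Comma] @ enc_label (fst (snd (gate x T X ?t))) @ enc_preds (snd (snd (gate x T X ?t))) @ [Semi]"
    by (simp add: enc_gate_def enc_preds_def gname_def glabel_def gpreds_def) (simp add: gate_def)
  then show ?thesis
    unfolding gate_prog_def c' tuple_at_def prod.case
    by (intro run_eq[OF emit_seqs_Cons[OF name emit_seqs_Cons[OF rest emit_seqs_Nil]]]) simp_all
qed

lemma run_main_prog:
  assumes "k \<le> K" "1 \<le> K"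
  shows "\<exists>s. exec RI x ((length x + 2) ^ K) (main_prog k K) (\<lambda>_. 0) s
     (enc_instance (circuit x ((length x + 2) ^ k) ((length x + 2) ^ K)) 1)"
proof -
  let ?n = "length x + 2"
  define B where "B = ?n ^ K"
  define T where "T = ?n ^ k"
  define s0 :: "reg \<Rightarrow> nat" where "s0 = (\<lambda>_. 0)(RI' := Suc (length x), RU' := T, RA' := B, RC' := B)"
  have init_prog: "run x B (init_prog k K) (\<lambda>_. 0) s0 []"
    unfolding B_def T_def s0_def by (rule run_init_prog[OF assms])
  have "?n ^ 1 \<le> ?n ^ K" using assms by (intro power_increasing) auto
  then have n: "Suc (length x) \<le> B" by (simp add: B_def)
  have T: "T \<le> B" unfolding T_def B_def using assms by (intro power_increasing) auto
  let ?w = "\<lambda>u i m j c. enc_gate (gate x T B (tuple_at B (u, i, m, j, c)))"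
  let ?s = "\<lambda>u i m j. s0(RU := u, RU' := T - u, RI := i, RI' := Suc (length x) - i,
    RA := m, RA' := B - m, RC := j, RC' := B - j)"
  have inner: "run x B (seqs (map gate_prog digit_choices)) (?s u i m j) (?s u i m j) (concat (map (?w u i m j) digit_choices))"
    if "u \<le> T" "i \<le> Suc (length x)" "m \<le> B" "j \<le> B" for u i m j
  proof (rule emit_seqs)
    fix c assume c: "c \<in> set digit_choices"
    have "ok x B (?s u i m j)"
      using that n T by (auto simp: ok_def s0_def)
    from run_gate_prog[OF this n _ _ _ c, of T B] that
    show "run x B (gate_prog c) (?s u i m j) (?s u i m j) (?w u i m j c)" by simp
  qed
  let ?s1 = "\<lambda>u. s0(RU := u, RU' := T - u)"
  let ?s2 = "\<lambda>u i. (?s1 u)(RI := i, RI' := Suc (length x) - i)"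
  let ?s3 = "\<lambda>u i m. (?s2 u i)(RA := m, RA' := B - m)"
  let ?c4 = "For RC RC' (seqs (map gate_prog digit_choices))"
  let ?w4 = "\<lambda>u i m. concat (map (\<lambda>j. concat (map (?w u i m j) digit_choices)) [0..<Suc B])"
  have 4: "run x B ?c4 (?s3 u i m) (?s3 u i m) (?w4 u i m)"
    if "u \<le> T" "i \<le> Suc (length x)" "m \<le> B" for u i m
  proof (rule run_For)
    fix j assume "j \<le> B"
    then show "run x B (seqs (map gate_prog digit_choices)) (?s u i m j) (?s u i m j) (concat (map (?w u i m j) digit_choices))"
      using that by (intro inner)
  qed (auto simp: s0_def)
  let ?c3 = "For RA RA' ?c4"
  let ?w3 = "\<lambda>u i. concat (map (?w4 u i) [0..<Suc B])"
  have 3: "run x B ?c3 (?s2 u i) (?s2 u i) (?w3 u i)" if "u \<le> T" "i \<le> Suc (length x)" for u i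
  proof (rule run_For)
    fix m assume "m \<le> B"
    then show "run x B ?c4 (?s3 u i m) (?s3 u i m) (?w4 u i m)"
      using that by (intro 4)
  qed (auto simp: s0_def)
  let ?c2 = "For RI RI' ?c3"
  let ?w2 = "\<lambda>u. concat (map (?w3 u) [0..<Suc (length x + 1)])"
  have 2: "run x B ?c2 (?s1 u) (?s1 u) (?w2 u)" if "u \<le> T" for u
  proof (rule run_For)
    fix i assume "i \<le> length x + 1"
    then show "run x B ?c3 ((?s1 u)(RI := i, RI' := length x + 1 - i)) ((?s1 u)(RI := i, RI' := length x + 1 - i)) (?w3 u i)"
      using that 3[of u i] by (simp only: Suc_eq_plus1)
  qed (use n in \<open>auto simp: s0_def\<close>)
  have "run x B (For RU RU' ?c2) s0 s0 (concat (map ?w2 [0..<Suc T]))"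
  proof (rule run_For)
    fix u assume "u \<le> T"
    then show "run x B ?c2 (?s1 u) (?s1 u) (?w2 u)" by (rule 2)
  qed (use T in \<open>auto simp: s0_def\<close>)
  moreover have "(concat (map (\<lambda>u. concat (map (\<lambda>i. concat (map (\<lambda>m. concat (map (\<lambda>j. concat (map (?w u i m j) digit_choices))
      [0..<Suc B])) [0..<Suc B])) [0..<Suc (length x + 1)])) [0..<Suc T]))
    = concat (map enc_gate (map (gate x T B) (tuples x T B)))"
    unfolding concat_map_product tuples_def map_map comp_def
    by (rule arg_cong[where f = concat], rule map_cong[OF refl]) auto
  ultimately have loops: "run x B (For RU RU' (For RI RI' (For RA RA' (For RC RC' (seqs (map gate_prog digit_choices)))))) s0 s0
    (concat (map enc_gate (map (gate x T B) (tuples x T B))))" by (simp only:)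
  have "run x B (main_prog k K) (\<lambda>_. 0) s0 (concat (map enc_gate (circuit x T B)) @ [Hash] @ enc_num 1)"
    unfolding main_prog_def
    by (rule run_eq[OF run_Seq[OF init_prog emit_seqs_Cons[OF run_outs emit_seqs_Cons[OF loops emit_seqs_Cons[OF run_outs emit_seqs_Nil]]]]])
      (simp_all add: circuit_def)
  then show ?thesis unfolding enc_instance_def B_def T_def by blast
qed

end

section \<open>Values of the gates\<close>

lemma sorted_map_fst_product: "sorted xs \<Longrightarrow> sorted (map fst (List.product xs ys))"
  by (induction xs) (auto simp: sorted_append comp_def map_replicate_const)

lemma mult_add_inj:
  assumes "y * n + l = y' * n + l'" "l < n" "l' < (n::nat)"
  shows "y = y' \<and> l = l'"
proof -
  have "(y * n + l) div n = y" "(y * n + l) mod n = l" "(y' * n + l') div n = y'" "(y' * n + l') mod n = l'"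
    using assms(2,3) by (simp_all add: div_mult_self3)
  then show ?thesis using assms(1) by simp
qed

context reduction
begin

fun fields :: "nat \<times> nat \<times> nat \<times> nat \<times> nat \<times> nat \<Rightarrow> nat list" where
  "fields (q, a, u, i, L, R) = [q, a, u, i, L, R]"

fun level :: "nat \<times> nat \<times> nat \<times> nat \<times> nat \<times> nat \<Rightarrow> nat" where
  "level (q, a, u, i, L, R) = u"

lemma gname_gate: "gname (gate x T X t) = gate_name (fields t)"
  by (cases t) (simp add: gate_def gname_def)

lemma fields_inj: "fields t = fields t' \<longleftrightarrow> t = t'"
  by (cases t; cases t') auto

text \<open>Mixed radix: a number below \<open>Suc X * b * b\<close> splits into an overflow digit,
  a middle part up to \<open>X\<close> and a lowest digit, so the enumeration fills a box.\<close>

lemma set_tuples: "(q, a, u, i, L, R) \<in> set (tuples x T X) \<longleftrightarrow>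
  q \<le> Q \<and> a < b \<and> u \<le> T \<and> i \<le> length x + 1 \<and> L < Suc X * b * b \<and> R < Suc X * b * b"
  (is "?l \<longleftrightarrow> ?r")
proof
  have less: "(h * Suc X + m) * b + l < Suc X * b * b" if "h < b" "m \<le> X" "l < b" for h m l
  proof -
    have "h * Suc X + m < Suc h * Suc X" using that by simp
    also have "\<dots> \<le> b * Suc X" using that by (intro mult_right_mono) auto
    finally have "(h * Suc X + m) * b + b \<le> (b * Suc X) * b"
      by (metis Suc_leI add.commute mult_Suc mult_le_mono1)
    then show ?thesis using that by (simp only: mult.commute[of b "Suc X"])
  qed
  show "?l \<Longrightarrow> ?r"
    using less by (auto simp: tuples_def tuple_at_def digit_choices_def simp del: mult_Suc mult_Suc_right upt_Suc)
next
  assume r: ?r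
  have split: "Y = (Y div b div Suc X * Suc X + Y div b mod Suc X) * b + Y mod b" for Y
    by (simp only: div_mult_mod_eq)
  have lt: "Y div b div Suc X < b" if "Y < Suc X * b * b" for Y
    using that by (metis less_mult_imp_div_less mult.assoc mult.commute)
  let ?p = "(u, i, L div b mod Suc X, R div b mod Suc X, q, a, L mod b, L div b div Suc X, R mod b, R div b div Suc X)"
  have "tuple_at X ?p = (q, a, u, i, L, R)"
    unfolding tuple_at_def prod.case using split by metis
  moreover have "?p \<in> set (List.product [0..<Suc T] (List.product [0..<Suc (length x + 1)]
     (List.product [0..<Suc X] (List.product [0..<Suc X] digit_choices))))"
    using r lt by (auto simp: digit_choices_def less_Suc_eq_le simp del: mult_Suc mult_Suc_right upt_Suc)
  ultimately show ?l unfolding tuples_def set_map by (rule image_eqI[OF sym])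
qed

lemma distinct_tuples: "distinct (tuples x T X)"
proof -
  let ?P = "List.product [0..<Suc T] (List.product [0..<Suc (length x + 1)]
     (List.product [0..<Suc X] (List.product [0..<Suc X] digit_choices)))"
  have "inj_on (tuple_at X) (set ?P)"
  proof (rule inj_onI)
    fix p p' assume p: "p \<in> set ?P" "p' \<in> set ?P" and eq: "tuple_at X p = tuple_at X p'"
    obtain u i m k q a l hl r hr where t: "p = (u, i, m, k, q, a, l, hl, r, hr)" by (metis prod.exhaust)
    obtain u' i' m' k' q' a' l' hl' r' hr' where t': "p' = (u', i', m', k', q', a', l', hl', r', hr')"
      by (metis prod.exhaust)
    have lt: "l < b" "r < b" "l' < b" "r' < b" "m < Suc X" "k < Suc X" "m' < Suc X" "k' < Suc X"
      using p by (auto simp: t t' digit_choices_def simp del: upt_Suc)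
    have e: "u = u'" "i = i'" "q = q'" "a = a'" "(hl * Suc X + m) * b + l = (hl' * Suc X + m') * b + l'"
      "(hr * Suc X + k) * b + r = (hr' * Suc X + k') * b + r'"
      using eq by (simp_all only: tuple_at_def t t' prod.case prod.inject)
    show "p = p'"
      using e(1-4) mult_add_inj[OF e(5) lt(1,3)] mult_add_inj[OF e(6) lt(2,4)] mult_add_inj lt(5-8)
      unfolding t t' by metis
  qed
  moreover have "distinct ?P" by (simp add: digit_choices_def distinct_product del: upt_Suc)
  ultimately show ?thesis unfolding tuples_def by (simp add: distinct_map)
qed

lemma sorted_levels: "sorted (map level (tuples x T X))"
proof -
  have "level \<circ> tuple_at X = fst" by (auto simp: fun_eq_iff tuple_at_def)
  then show ?thesis
    unfolding tuples_def map_map by (simp only:) (intro sorted_map_fst_product sorted_upt)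
qed

text \<open>Without overflow \<open>L < Suc X * b\<close>, and a push multiplies by \<open>b\<close>
  and adds a digit; the second factor \<open>b\<close> in the range of the box makes room for
  this.\<close>

lemma succ_in_tuples:
  assumes t: "t \<in> set (tuples x T X)" and small: "level t < T"
    and b: "\<not> (\<exists>q a u i L R. t = (q, a, u, i, L, R) \<and> (L div b > X \<or> R div b > X))"
  shows "\<exists>t'\<in>set (tuples x T X). succ x coin t = fields t' \<and> level t' = Suc (level t)"
proof -
  obtain q a u i L R where t': "t = (q, a, u, i, L, R)" by (metis prod.exhaust)
  have r: "q \<le> Q" "a < b" "u \<le> T" "i \<le> length x + 1" "L < Suc X * b * b" "R < Suc X * b * b"
    using t unfolding t' set_tuples by auto
  have LR: "L div b < Suc X" "R div b < Suc X" using b t' by auto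
  obtain q' d a' e where D: "trans q (inp x i) a coin = (q', d, a', e)" by (metis prod.exhaust)
  have q': "q' \<le> Q" "a' < b" "e \<noteq> 0 \<Longrightarrow> a' < p_nsyms M" using trans_range[OF D] r by auto
  have i': "move i d (length x + 1) \<le> length x + 1" by (simp add: move_def)
  have u: "Suc u \<le> T" using small t' by simp
  have push: "Y * b + v < Suc X * b * b" if "Y div b < Suc X" "v < b" for Y v
  proof -
    have "Y < Suc X * b" using that(1) by (simp only: div_less_iff_less_mult zero_less_Suc)
    then have "Suc Y * b \<le> Suc X * b * b" by (intro mult_right_mono) auto
    then show ?thesis using that(2) by simp
  qed
  have pop: "Y div b < Suc X * b * b" if "Y < Suc X * b * b" for Y
    using that div_le_dividend[of Y b] by linarith
  let ?i = "move i d (length x + 1)"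
  have m: "Y mod b < b" for Y by simp
  consider "e = 1" | "e = -1 \<and> L mod b \<noteq> 0" "e \<noteq> 1" | "e \<noteq> 1" "\<not> (e = -1 \<and> L mod b \<noteq> 0)" by blast
  then show ?thesis
  proof cases
    case 1
    have "(q', R mod b, Suc u, ?i, L * b + Suc a', R div b) \<in> set (tuples x T X)"
      unfolding set_tuples using q' i' u push[OF LR(1), of "Suc a'"] pop[OF r(6)] m[of R] 1 by auto
    moreover have "succ x coin t = [q', R mod b, Suc u, ?i, L * b + Suc a', R div b]"
      unfolding succ_def t' prod.case D Let_def if_P[OF 1] by (rule refl)
    ultimately show ?thesis by (intro bexI) (auto simp: t')
  next
    case 2
    have "(q', L mod b - 1, Suc u, ?i, L div b, R * b + a') \<in> set (tuples x T X)"
      unfolding set_tuples using q' i' u push[OF LR(2), of a'] pop[OF r(5)] less_imp_diff_less[OF m[of L], of 1] by auto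
    moreover have "succ x coin t = [q', L mod b - 1, Suc u, ?i, L div b, R * b + a']"
      unfolding succ_def t' prod.case D Let_def if_P[OF 2(1)] if_not_P[OF 2(2)] by (rule refl)
    ultimately show ?thesis by (intro bexI) (auto simp: t')
  next
    case 3
    have "(q', a', Suc u, ?i, L, R) \<in> set (tuples x T X)"
      unfolding set_tuples using q' i' u r by auto
    moreover have "succ x coin t = [q', a', Suc u, ?i, L, R]"
      unfolding succ_def t' prod.case D Let_def if_not_P[OF 3(2)] if_not_P[OF 3(1)] by (rule refl)
    ultimately show ?thesis by (intro bexI) (auto simp: t')
  qed
qed

lemma start_less: "p_start M < Q"
  using M by (simp add: ptm_wf_def)

lemma start_tuples: "(p_start M, 0, 0, 0, 0, 0) \<in> set (tuples x T X)" "(Q, 0, 0, 0, 0, 0) \<in> set (tuples x T X)"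
  using start_less by (auto simp: set_tuples)

lemma wf_circuit_circuit: "wf_circuit {OTimes, ODiv} (circuit x T X)"
proof (rule wf_circuitI)
  let ?ts = "tuples x T X"
  \<comment> \<open>The header gets the keys 0 to 3, and the tuples follow with their time shifted
    by 4.\<close>
  define ks where "ks = [0, 1, 2, 3] @ map (\<lambda>t. level t + 4) ?ts"
  show "circuit x T X \<noteq> []" by (simp add: circuit_def header_def)
  have big: "64 \<le> gate_name (fields t)" for t using gate_name_ge[of "fields t"] by (cases t) simp
  have "distinct (map gname (map (gate x T X) ?ts))"
    using distinct_tuples unfolding map_map comp_def gname_gate
    by (simp add: distinct_map inj_on_def gate_name_inj fields_inj)
  moreover have "n \<noteq> gate_name (fields t)" if "n < 64" for n t using big[of t] that by auto
  ultimately show "distinct (map gname (circuit x T X))"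
    unfolding circuit_def header_def by (auto simp: gname_gate) (auto simp: gname_def)
  have "sorted (map (\<lambda>t. level t + 4) ?ts)"
    using sorted_levels[of x T X] unfolding sorted_map by (auto elim: sorted_wrt_mono_rel[rotated])
  then show "sorted ks" by (auto simp: ks_def sorted_append)
  show "length ks = length (circuit x T X)" by (simp add: ks_def circuit_def header_def)
  have late: "\<exists>j<length (circuit x T X). n < ks ! j \<and> gname (circuit x T X ! j) = gate_name (fields t)"
    if "t \<in> set ?ts" "n < level t + 4" for n t
  proof -
    obtain j where j: "j < length ?ts" "?ts ! j = t" using \<open>t \<in> set ?ts\<close> by (metis in_set_conv_nth)
    have "ks ! (j + 4) = level t + 4" "circuit x T X ! (j + 4) = gate x T X t"
      using j by (auto simp: ks_def circuit_def header_def nth_append)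
    then show ?thesis
      using that j by (intro exI[of _ "j + 4"]) (auto simp: gname_gate circuit_def header_def)
  qed
  fix i p assume i: "i < length (circuit x T X)" and p: "p \<in> set (gpreds (circuit x T X ! i))"
  show "\<exists>j<length (circuit x T X). ks ! i < ks ! j \<and> gname (circuit x T X ! j) = p"
  proof (cases "i < 4")
    case True
    have h: "circuit x T X ! j = header ! j" "ks ! j = j" "j < length (circuit x T X)" if "j < 4" for j
    proof -
      have "length header = 4" by (simp add: header_def)
      then show "circuit x T X ! j = header ! j" "j < length (circuit x T X)"
        using that by (auto simp: circuit_def nth_append)
      have ks: "ks ! j = [0, 1, 2, 3] ! j" using that unfolding ks_def by (subst nth_append) simp
      from that consider "j = 0" | "j = 1" | "j = 2" | "j = 3" by linarith
      then show "ks ! j = j" unfolding ks by cases simp_all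
    qed
    from True consider "i = 0" | "i = 1" | "i = 2" | "i = 3" by linarith
    then show ?thesis
    proof cases
      case 1
      then have "p = 2" using p h(1)[of 0] by (simp add: header_def gpreds_def)
      then show ?thesis using h[of 1] h[of 0] 1 by (intro exI[of _ 1]) (simp add: header_def gname_def)
    next
      case 2
      then have "p = 3 \<or> p = 4" using p h(1)[of 1] by (simp add: header_def gpreds_def)
      then show ?thesis
        using h[of 1] h[of 2] h[of 3] 2 by (intro exI[of _ "p - 1"]) (auto simp: header_def gname_def)
    next
      case 3
      then have "p = gate_name (fields (p_start M, 0, 0, 0, 0, 0)) \<or> p = gate_name (fields (Q, 0, 0, 0, 0, 0))"
        using p h(1)[of 2] by (simp add: header_def gpreds_def)
      then show ?thesis using late[OF start_tuples(1), of "ks ! i"] late[OF start_tuples(2), of "ks ! i"] h[of 2] 3 by auto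
    next
      case 4
      then show ?thesis using p h(1)[of 3] by (simp add: header_def gpreds_def)
    qed
  next
    case False
    let ?t = "?ts ! (i - 4)"
    have l: "i - 4 < length ?ts" using i False by (auto simp: circuit_def header_def)
    have g: "circuit x T X ! i = gate x T X ?t" "ks ! i = level ?t + 4"
      using l False by (auto simp: circuit_def header_def ks_def nth_append numeral_eq_Suc)
    have t: "?t \<in> set ?ts" using l by simp
    \<comment> \<open>A gate with predecessors is neither an overflow gate nor a leaf.\<close>
    have lev: "level ?t < T" and small: "\<not> (\<exists>q a u i L R. ?t = (q, a, u, i, L, R) \<and> (L div b > X \<or> R div b > X))"
      and "\<exists>coin. p = gate_name (succ x coin ?t)"
      using p unfolding g by (cases ?t; auto simp: gate_def gpreds_def split: if_splits)+
    then obtain coin where "p = gate_name (succ x coin ?t)" by blast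
    with succ_in_tuples[OF t lev small, of coin] late show ?thesis unfolding g by fastforce
  qed
next
  fix g assume "g \<in> set (circuit x T X)"
  then show "case glabel g of In k \<Rightarrow> gpreds g = []
         | Op OCompl \<Rightarrow> length (gpreds g) = 1 \<and> OCompl \<in> {OTimes, ODiv}
         | Op f \<Rightarrow> length (gpreds g) = 2 \<and> f \<in> {OTimes, ODiv}"
    by (auto simp: circuit_def header_def gate_def glabel_def gpreds_def)
qed

end

lemma set_times_commute: "set_times A B = set_times B A"
  unfolding set_times_def by (metis mult.commute)

lemma set_times_singleton: "set_times {m} {n} = {m * n}"
  by (auto simp: set_times_def)

lemma sort_pair: "sort [x, y] = (if x \<le> y then [x, y] else [y, x])" for x y :: nat
  by simp

context reduction
begin

abbreviation "val x T X \<equiv> eval_gates (circuit x T X)"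

lemma val_gate: "g \<in> set (circuit x T X) \<Longrightarrow>
  val x T X (gname g) = gate_val (glabel g) (map (val x T X) (sort (gpreds g)))"
  using eval_wf_circuit[OF wf_circuit_circuit] .

lemma val_tuple:
  assumes "t \<in> set (tuples x T X)"
  shows "val x T X (gate_name (fields t)) =
    gate_val (glabel (gate x T X t)) (map (val x T X) (sort (gpreds (gate x T X t))))"
  using val_gate[of "gate x T X t" x T X] assms by (simp add: gname_gate circuit_def)

text \<open>The names of the two successors may be in either order; multiplication commutes, so the
  sorting does no harm.\<close>

lemma val_times:
  assumes "(q, a, u, i, L, R) \<in> set (tuples x T X)" "L div b \<le> X" "R div b \<le> X" "u < T"
  shows "val x T X (gate_name [q, a, u, i, L, R]) =
    set_times (val x T X (gate_name (succ x True (q, a, u, i, L, R)))) (val x T X (gate_name (succ x False (q, a, u, i, L, R))))"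
proof -
  have g: "gate x T X (q, a, u, i, L, R) = (gate_name [q, a, u, i, L, R], Op OTimes,
      [gate_name (succ x True (q, a, u, i, L, R)), gate_name (succ x False (q, a, u, i, L, R))])"
    using assms(2-4) by (simp add: gate_def)
  have "val x T X (gate_name [q, a, u, i, L, R]) = gate_val (Op OTimes) (map (val x T X)
      (sort [gate_name (succ x True (q, a, u, i, L, R)), gate_name (succ x False (q, a, u, i, L, R))]))"
    using val_tuple[OF assms(1)] unfolding g fields.simps glabel_def gpreds_def fst_conv snd_conv .
  then show ?thesis
    unfolding sort_pair using set_times_commute by simp
qed

lemma val_leaf:
  assumes "(q, a, T, i, L, R) \<in> set (tuples x T X)" "L div b \<le> X" "R div b \<le> X"
  shows "val x T X (gate_name [q, a, T, i, L, R]) = {leaf q}"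
  using val_tuple[OF assms(1)] assms(2,3) by (simp add: gate_def glabel_def gpreds_def)

section \<open>Accepting coin sequences and tape contents as numbers\<close>

definition count :: "bool list \<Rightarrow> pconf \<Rightarrow> nat \<Rightarrow> nat" where
  "count x C d = card {cs. length cs = d \<and> fst (foldl (ptm_step M x) C cs) = p_acc M}"

lemma count_0: "count x C 0 = (if fst C = p_acc M then 1 else 0)"
proof -
  have "{cs. length cs = 0 \<and> fst (foldl (ptm_step M x) C cs) = p_acc M} = (if fst C = p_acc M then {[]} else {})"
    by auto
  then show ?thesis by (simp add: count_def)
qed

lemma count_Suc: "count x C (Suc d) = count x (ptm_step M x C True) d + count x (ptm_step M x C False) d"
proof -
  let ?A = "\<lambda>C. {cs. length cs = d \<and> fst (foldl (ptm_step M x) C cs) = p_acc M}"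
  have fin: "finite (?A C)" for C
    by (rule finite_subset[OF _ finite_lists_length_eq[of "UNIV :: bool set" d]]) auto
  have "{cs. length cs = Suc d \<and> fst (foldl (ptm_step M x) C cs) = p_acc M}
     = Cons True ` ?A (ptm_step M x C True) \<union> Cons False ` ?A (ptm_step M x C False)" (is "?l = ?r")
  proof (rule set_eqI)
    fix cs show "cs \<in> ?l \<longleftrightarrow> cs \<in> ?r"
      by (cases cs; cases "hd cs") auto
  qed
  moreover have "card ?r = card (?A (ptm_step M x C True)) + card (?A (ptm_step M x C False))"
    using fin by (subst card_Un_disjoint) (auto simp: card_image)
  ultimately show ?thesis by (simp add: count_def)
qed

primrec left :: "(nat \<Rightarrow> nat) \<Rightarrow> nat \<Rightarrow> nat" where
  "left tp 0 = 0"
| "left tp (Suc w) = left tp w * b + Suc (tp w)"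

text \<open>The tape is infinite, so only a window of \<open>n\<close> cells is read;
  \<open>tuple_of\<close> ends it at cell \<open>S\<close>, the space bound.\<close>

primrec right :: "(nat \<Rightarrow> nat) \<Rightarrow> nat \<Rightarrow> nat \<Rightarrow> nat" where
  "right tp p 0 = 0"
| "right tp p (Suc n) = right tp (Suc p) n * b + tp p"

lemma left_upd: "w \<le> v \<Longrightarrow> left (tp(v := a)) w = left tp w"
  by (induction w) auto

lemma right_upd: "v < p \<Longrightarrow> right (tp(v := a)) p n = right tp p n"
  by (induction n arbitrary: p) auto

lemma append_digit_less:
  assumes "y < b ^ n" "v < b"
  shows "y * b + v < b ^ Suc n"
proof -
  have "Suc y * b \<le> b ^ n * b" using assms(1) by (intro mult_right_mono) auto
  then have "y * b + v < b ^ n * b" using assms(2) by (simp only: mult_Suc)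
  then show ?thesis by (simp only: power_Suc2)
qed

lemma left_less: "(\<And>j. tp j < p_nsyms M) \<Longrightarrow> left tp w < b ^ w"
proof (induction w)
  case (Suc w)
  then show ?case using append_digit_less[of "left tp w" w "Suc (tp w)"] by (simp only: left.simps) simp
qed simp

lemma right_less: "(\<And>j. tp j < p_nsyms M) \<Longrightarrow> right tp p n < b ^ n"
proof (induction n arbitrary: p)
  case (Suc n)
  have "tp p < b" using Suc.prems[of p] by simp
  then show ?case using append_digit_less[OF Suc.IH[OF Suc.prems]] by (simp only: right.simps)
qed simp

definition good :: "bool list \<Rightarrow> pconf \<Rightarrow> bool" where
  "good x = (\<lambda>(q, ih, tp, w). q < Q \<and> ih \<le> length x + 1 \<and> (\<forall>j. tp j < p_nsyms M))"

definition tuple_of :: "nat \<Rightarrow> nat \<Rightarrow> pconf \<Rightarrow> nat \<times> nat \<times> nat \<times> nat \<times> nat \<times> nat" where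
  "tuple_of S u = (\<lambda>(q, ih, tp, w). (q, tp w, u, ih, left tp w, right tp (Suc w) (S - w)))"

abbreviation whd :: "pconf \<Rightarrow> nat" where "whd C \<equiv> snd (snd (snd C))"

lemma p_delta_range:
  assumes "q < Q" "a < p_nsyms M" "p_delta M q y a coin = (q', d, a', e)"
  shows "q' < Q \<and> a' < p_nsyms M \<and> d \<in> {-1, 0, 1} \<and> e \<in> {-1, 0, 1}"
proof -
  have "case p_delta M q y a coin of (q', d, a', e) \<Rightarrow>
      q' < p_nstates M \<and> a' < p_nsyms M \<and> d \<in> {-1, 0, 1} \<and> e \<in> {-1, 0, 1}"
    using M assms(1,2) by (simp add: ptm_wf_def)
  then show ?thesis using assms(3) by simp
qed

lemma good_step:
  assumes "good x C"
  shows "good x (ptm_step M x C coin)"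
proof (cases "ptm_halted M C")
  case False
  obtain q ih tp w where C: "C = (q, ih, tp, w)" by (metis prod.exhaust)
  obtain q' d a' e where D: "p_delta M q (inp x ih) (tp w) coin = (q', d, a', e)" by (metis prod.exhaust)
  have "q' < Q" "a' < p_nsyms M" using p_delta_range[OF _ _ D] assms by (auto simp: good_def C)
  moreover have "move ih d (length x + 1) \<le> length x + 1" by (simp add: move_def)
  ultimately show ?thesis using assms False D unfolding ptm_step_def by (auto simp: good_def C)
qed (use assms in \<open>simp add: ptm_step_def\<close>)

text \<open>The digit arithmetic follows the machine exactly while the head stays in cells 0 to
  \<open>S\<close>: a right move takes a cell from the right window, a left move returns
  one.\<close>

lemma succ_step:
  assumes good: "good x C" and w: "whd C \<le> S" "whd (ptm_step M x C coin) \<le> S"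
  shows "succ x coin (tuple_of S u C) = fields (tuple_of S (Suc u) (ptm_step M x C coin))"
proof -
  obtain q ih tp w where C: "C = (q, ih, tp, w)" by (metis prod.exhaust)
  have g: "q < Q" "ih \<le> length x + 1" "tp j < p_nsyms M" for j using good by (auto simp: good_def C)
  show ?thesis
  proof (cases "ptm_halted M C")
    case True
    then have "trans q (inp x ih) (tp w) coin = (q, 0, tp w, 0)" by (auto simp: trans_def ptm_halted_def C)
    then show ?thesis using True g by (simp add: ptm_step_def succ_def tuple_of_def C)
  next
    case False
    obtain q' d a' e where D: "p_delta M q (inp x ih) (tp w) coin = (q', d, a', e)" by (metis prod.exhaust)
    have trans: "trans q (inp x ih) (tp w) coin = (q', d, a', e)"
      using False g D by (auto simp: trans_def ptm_halted_def C)
    have e: "e \<in> {-1, 0, 1}" using p_delta_range[OF g(1,3) D] by simp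
    let ?i = "move ih d (length x + 1)" and ?tp = "tp(w := a')"
    have step: "ptm_step M x C coin = (q', ?i, ?tp, nat (max 0 (int w + e)))"
      using False D by (simp add: ptm_step_def C)
    let ?L = "left tp w" and ?R = "right tp (Suc w) (S - w)"
    have S: "succ x coin (tuple_of S u C) =
      (if e = 1 then [q', ?R mod b, Suc u, ?i, ?L * b + Suc a', ?R div b]
       else if e = -1 \<and> ?L mod b \<noteq> 0 then [q', ?L mod b - 1, Suc u, ?i, ?L div b, ?R * b + a']
       else [q', a', Suc u, ?i, ?L, ?R])"
      unfolding succ_def tuple_of_def C prod.case trans Let_def by (rule refl)
    consider "e = 1" | v where "e = -1" "w = Suc v" | "e = -1" "w = 0" | "e = 0"
      using e by (cases w) auto
    then show ?thesis
    proof cases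
      case 1
      \<comment> \<open>The bound after the step shows that the right window still contains the cell
        moved to.\<close>
      have "Suc w \<le> S" using w(2) 1 by (simp add: step nat_add_distrib)
      then have n: "S - w = Suc (S - Suc w)" by simp
      have R: "?R mod b = tp (Suc w)" "?R div b = right tp (Suc (Suc w)) (S - Suc w)"
        using g(3)[of "Suc w"] unfolding n right.simps by (simp_all add: div_mult_self3 del: mult_Suc_right)
      have nw: "nat (max 0 (int w + e)) = Suc w" using 1 by simp
      show ?thesis unfolding S if_P[OF 1] R step nw
        by (simp add: tuple_of_def left_upd right_upd del: mult_Suc_right)
    next
      case 2
      have "v < S" using w(1) 2 by (simp add: C)
      then have n: "S - v = Suc (S - Suc v)" by simp
      have "Suc (tp v) < b" using g(3)[of v] by simp
      then have L: "?L mod b = Suc (tp v)" "?L div b = left tp v"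
        unfolding 2(2) left.simps by (simp_all only: div_mult_self3 mod_mult_self3 div_less mod_less)
      have nw: "nat (max 0 (int w + e)) = v" using 2 by simp
      show ?thesis unfolding S L step nw using 2 n
        by (simp add: tuple_of_def left_upd right_upd del: mult_Suc_right)
    next
      \<comment> \<open>At cell 0 the left number is 0, so the clamped left move falls into the
        branch that stays.\<close>
      case 3
      then show ?thesis unfolding S step by (simp add: tuple_of_def right_upd)
    next
      case 4
      then show ?thesis unfolding S step by (simp add: tuple_of_def left_upd right_upd)
    qed
  qed
qed

text \<open>As \<open>b ^ S <= X\<close>, the overflow guard never fires on configurations within
  the space bound.\<close>

lemma tuple_of_in_tuples:
  assumes "b ^ S \<le> X" "good x C" "u \<le> T" "whd C \<le> S" "tuple_of S u C = (q, a, u', i, L, R)"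
  shows "u' = u \<and> q = fst C \<and> q < Q \<and> L div b \<le> X \<and> R div b \<le> X \<and> (q, a, u', i, L, R) \<in> set (tuples x T X)"
proof -
  obtain p ih tp w where C: "C = (p, ih, tp, w)" by (metis prod.exhaust)
  have t: "q = p" "a = tp w" "u' = u" "i = ih" "L = left tp w" "R = right tp (Suc w) (S - w)"
    using assms(5) by (auto simp: C tuple_of_def)
  have g: "p < Q" "ih \<le> length x + 1" "tp j < p_nsyms M" for j using assms(2) by (auto simp: good_def C)
  have "L < b ^ w" "R < b ^ (S - w)" unfolding t by (rule left_less[OF g(3)], rule right_less[OF g(3)])
  moreover have "b ^ w \<le> b ^ S" "b ^ (S - w) \<le> b ^ S"
    using assms(4) by (simp_all add: C power_increasing del: power_increasing_iff)
  ultimately have LR: "L \<le> X" "R \<le> X" using assms(1) by linarith+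
  have "X < Suc X * b * b" by (simp add: algebra_simps)
  moreover have "L div b \<le> X" "R div b \<le> X"
    using LR div_le_dividend order_trans by blast+
  moreover have "tp w < b" using g(3)[of w] by simp
  ultimately show ?thesis
    using LR g(1,2) assms(3) by (simp add: set_tuples t(1-4) C del: mult_Suc mult_Suc_right)
qed

text \<open>Induction on the remaining time. The head bound is assumed for all continuations, so
  that it passes to both successors.\<close>

lemma val_config:
  assumes S: "b ^ S \<le> X" and "good x C" "u \<le> T" "\<And>cs. whd (foldl (ptm_step M x) C cs) \<le> S"
  shows "val x T X (gate_name (fields (tuple_of S u C))) = {4 ^ count x C (T - u)}"
  using assms(2-4)
proof (induction "T - u" arbitrary: u C)
  case (0 u C)
  then have u: "u = T" by simp
  obtain q a u' i L R where t: "tuple_of S u C = (q, a, u', i, L, R)" by (metis prod.exhaust)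
  have "whd C \<le> S" using 0(4)[of "[]"] by simp
  note m = tuple_of_in_tuples[OF S 0(2,3) this t]
  then have "val x T X (gate_name [q, a, T, i, L, R]) = {leaf q}" using u by (intro val_leaf) auto
  then show ?case using m u unfolding t by (auto simp: leaf_def count_0)
next
  case (Suc d u C)
  then have u: "u < T" by simp
  obtain q a u' i L R where t: "tuple_of S u C = (q, a, u', i, L, R)" by (metis prod.exhaust)
  have w: "whd C \<le> S" "whd (ptm_step M x C coin) \<le> S" for coin
    using Suc(5)[of "[]"] Suc(5)[of "[coin]"] by simp_all
  note m = tuple_of_in_tuples[OF S Suc(3,4) w(1) t]
  have IH: "val x T X (gate_name (succ x coin (tuple_of S u C))) = {4 ^ count x (ptm_step M x C coin) d}" for coin
  proof -
    have d: "d = T - Suc u" using Suc.hyps(2) by simp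
    have b: "whd (foldl (ptm_step M x) (ptm_step M x C coin) cs) \<le> S" for cs
      using Suc(5)[of "coin # cs"] by simp
    show ?thesis
      unfolding succ_step[OF Suc(3) w] using Suc.hyps(1)[OF d good_step[OF Suc(3)] _ b] u d by simp
  qed
  have "val x T X (gate_name (fields (tuple_of S u C))) =
      set_times (val x T X (gate_name (succ x True (tuple_of S u C)))) (val x T X (gate_name (succ x False (tuple_of S u C))))"
    unfolding t fields.simps using m u by (intro val_times) auto
  also have "\<dots> = {4 ^ count x C (Suc d)}"
    unfolding IH set_times_singleton count_Suc power_add ..
  finally show ?case using Suc.hyps(2) by simp
qed

text \<open>Both successors are the dummy one step later, so each level squares the value, starting
  from the leaf 2.\<close>

lemma val_dummy: "u \<le> T \<Longrightarrow> val x T X (gate_name [Q, 0, u, 0, 0, 0]) = {2 ^ 2 ^ (T - u)}"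
proof (induction "T - u" arbitrary: u)
  case 0
  then have "u = T" by simp
  moreover have "p_acc M \<noteq> Q" using M by (auto simp: ptm_wf_def)
  ultimately show ?case by (simp add: val_leaf set_tuples leaf_def)
next
  case (Suc d)
  have s: "succ x coin (Q, 0, u, 0, 0, 0) = [Q, 0, Suc u, 0, 0, 0]" for coin
    by (simp add: succ_def trans_def)
  have "val x T X (gate_name [Q, 0, u, 0, 0, 0]) = set_times (val x T X (gate_name [Q, 0, Suc u, 0, 0, 0])) (val x T X (gate_name [Q, 0, Suc u, 0, 0, 0]))"
    using Suc.hyps(2) by (subst val_times) (simp_all add: set_tuples s)
  also have "val x T X (gate_name [Q, 0, Suc u, 0, 0, 0]) = {2 ^ 2 ^ d}"
    using Suc.hyps(1)[of "Suc u"] Suc.hyps(2) by simp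
  also have "set_times {2 ^ 2 ^ d} {2 ^ 2 ^ d} = {2 ^ 2 ^ Suc d :: nat}"
    by (simp add: set_times_singleton mult_2 flip: power_add)
  finally show ?case using Suc.hyps(2) by simp
qed

lemma circuit_val_iff:
  assumes S: "b ^ S \<le> X" and w: "\<And>cs. whd (ptm_run M x cs) \<le> S"
  shows "1 \<in> circuit_val (circuit x T X) \<longleftrightarrow>
    2 * card {cs. length cs = T \<and> ptm_accepts M x cs} > 2 ^ T"
proof -
  let ?C = "(p_start M, 0, (\<lambda>_. 0), 0) :: pconf"
  let ?n = "card {cs. length cs = T \<and> ptm_accepts M x cs}"
  let ?G = "gate_name [p_start M, 0, 0, 0, 0, 0]" and ?H = "gate_name [Q, 0, 0, 0, 0, 0]"
  have "0 < p_nsyms M" using M by (simp add: ptm_wf_def)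
  then have good: "good x ?C" using start_less by (simp add: good_def)
  have "right (\<lambda>_. 0) p n = 0" for p n by (induction n arbitrary: p) auto
  then have "tuple_of S 0 ?C = (p_start M, 0, 0, 0, 0, 0)" by (simp add: tuple_of_def)
  moreover have "count x ?C T = ?n" by (simp add: count_def ptm_accepts_def ptm_run_def)
  ultimately have G: "val x T X ?G = {4 ^ ?n}"
    using val_config[OF S good _ w[unfolded ptm_run_def], of 0 T] by simp
  have H: "val x T X ?H = {2 ^ 2 ^ T}" using val_dummy[of 0 T x X] by simp
  \<comment> \<open>The larger state number gives the dummy the larger name and makes it the
    divisor.\<close>
  have "?G < ?H" using start_less by (intro gate_name_less) simp
  then have sort: "sort [?G, ?H] = [?G, ?H]" by simp
  have h: "val x T X (gname g) = gate_val (glabel g) (map (val x T X) (sort (gpreds g)))" if "g \<in> set header" for g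
    using that by (intro val_gate) (simp add: circuit_def)
  have 4: "val x T X 4 = {2}"
    using h[of "(4, In 2, [])"] by (simp add: header_def gname_def glabel_def gpreds_def)
  have 3: "val x T X 3 = set_div (val x T X ?G) (val x T X ?H)"
    using h[of "(3, Op ODiv, [?G, ?H])"] sort by (simp add: header_def gname_def glabel_def gpreds_def del: sort_key_simps)
  have 2: "val x T X 2 = set_div (val x T X 3) (val x T X 4)"
    using h[of "(2, Op ODiv, [3, 4])"] by (simp add: header_def gname_def glabel_def gpreds_def)
  have 1: "val x T X 1 = set_div (val x T X 2) (val x T X 2)"
    using h[of "(1, Op ODiv, [2, 2])"] by (simp add: header_def gname_def glabel_def gpreds_def)
  have in3: "c \<in> val x T X 3 \<longleftrightarrow> 4 ^ ?n = c * 2 ^ 2 ^ T" for c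
    unfolding 3 G H by (auto simp: set_div_def)
  have in2: "c \<in> val x T X 2 \<longleftrightarrow> 2 ^ (2 * ?n) = c * 2 ^ Suc (2 ^ T)" for c
    unfolding 2 4 set_div_def using in3 by (auto simp: power_mult mult.assoc)
  have "1 \<in> circuit_val (circuit x T X) \<longleftrightarrow> 1 \<in> val x T X 1"
    by (simp add: circuit_val_def circuit_def header_def gname_def)
  also have "\<dots> \<longleftrightarrow> (\<exists>c. c \<in> val x T X 2 \<and> c \<noteq> 0)"
    unfolding 1 set_div_def by auto
  also have "\<dots> \<longleftrightarrow> (2::nat) ^ Suc (2 ^ T) dvd 2 ^ (2 * ?n)"
  proof -
    \<comment> \<open>Division ignores zero divisors, but gate 2 contains none: a power of 2 is no
      multiple of 0. So \<open>D / D\<close> has the element 1 as soon as \<open>D\<close> is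
      nonempty.\<close>
    have "c \<noteq> 0" if "2 ^ (2 * ?n) = 2 ^ Suc (2 ^ T) * c" for c :: nat
      by (rule notI) (use that in simp)
    then show ?thesis unfolding in2 dvd_def mult.commute[of _ "2 ^ Suc (2 ^ T)"] by blast
  qed
  also have "\<dots> \<longleftrightarrow> Suc (2 ^ T) \<le> 2 * ?n"
    by (rule dvd_power_iff_le) simp
  finally show ?thesis by (simp add: Suc_le_eq)
qed

end

text \<open>Rests on \<open>b powr (c * log 2 m) = m powr (c * log 2 b)\<close>: tape contents of
  logarithmic length are polynomially many.\<close>

lemma space_bound:
  fixes c :: real and b n :: nat
  assumes "1 \<le> b" "0 \<le> c * log 2 (real n + 2)" "c * log 2 (real b) \<le> real K"
  shows "b ^ nat \<lfloor>c * log 2 (real n + 2)\<rfloor> \<le> (n + 2) ^ K"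
proof -
  let ?S = "nat \<lfloor>c * log 2 (real n + 2)\<rfloor>"
  have "real b ^ ?S = real b powr real ?S" using assms(1) by (simp add: powr_realpow)
  also have "\<dots> \<le> real b powr (c * log 2 (real n + 2))"
    using assms(1,2) by (intro powr_mono) auto
  also have "\<dots> = (real n + 2) powr (c * log 2 (real b))"
    using assms(1) by (simp add: powr_def log_def)
  also have "\<dots> \<le> (real n + 2) powr real K" using assms(3) by (intro powr_mono) auto
  also have "\<dots> = real ((n + 2) ^ K)" by (simp add: powr_realpow add.commute)
  finally have "real (b ^ ?S) \<le> real ((n + 2) ^ K)" by simp
  then show ?thesis by (simp only: of_nat_le_iff)
qed

theorem theorem9:
  shows "PL_hard (MC {OTimes, ODiv})"
  unfolding PL_hard_def
proof
  fix L assume "L \<in> PL"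
  then obtain M k c where M: "ptm_wf M"
    and space: "\<And>x cs. real (snd (snd (snd (ptm_run M x cs)))) \<le> c * log 2 (real (length x) + 2)"
    and L: "\<And>x. x \<in> L \<longleftrightarrow> 2 * card {cs. length cs = (length x + 2) ^ k \<and> ptm_accepts M x cs}
           > 2 ^ ((length x + 2) ^ k)"
    unfolding PL_def by blast
  interpret reduction M by unfold_locales (rule M)
  \<comment> \<open>One exponent serves three bounds: \<open>k\<close> for the time, 1 for the input
    length, and \<open>c * log 2 b\<close> for the tape numbers.\<close>
  define K where "K = max (max k 1) (nat \<lceil>c * log 2 (real (Suc (p_nsyms M)))\<rceil>)"
  have K: "k \<le> K" "1 \<le> K" "c * log 2 (real (Suc (p_nsyms M))) \<le> real K"
    unfolding K_def by (simp_all add: le_max_iff_disj of_nat_max) linarith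
  show "logspace_reducible L (MC {OTimes, ODiv})"
  proof (rule logspace_reducibleI[OF run_main_prog[OF K(1,2)]])
    fix x :: "bool list"
    let ?S = "nat \<lfloor>c * log 2 (real (length x) + 2)\<rfloor>"
    \<comment> \<open>The sign of \<open>c\<close> is not given; the head position of the start
      configuration, a natural number, lies below this product.\<close>
    have "0 \<le> c * log 2 (real (length x) + 2)"
      using space[of x "[]"] order_trans[OF of_nat_0_le_iff] by blast
    then have S: "Suc (p_nsyms M) ^ ?S \<le> (length x + 2) ^ K" by (intro space_bound K(3)) simp_all
    have "snd (snd (snd (ptm_run M x cs))) \<le> ?S" for cs
      using space[of x cs] by (simp add: le_nat_floor)
    from circuit_val_iff[OF S this, of "(length x + 2) ^ k"]
    show "x \<in> L \<longleftrightarrow> enc_instance (circuit x ((length x + 2) ^ k) ((length x + 2) ^ K)) 1 \<in> MC {OTimes, ODiv}"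
      unfolding L MC_iff using wf_circuit_circuit by simp
  qed
qed

end
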